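(* Let $d\ge2$. Let $\Omega_{ext}\subset\mathbf Z^d$ be a connected exterior domain satisfying the cone condition, let $\widehat V$ be a real-valued compactly supported potential on $\Omega_{ext}$, and let $\widehat H_{ext}=-\Delta_{disc}+\widehat V$. Suppose there exist $\lambda\in(0,d)$ and a function $\widehat u:\Omega_{ext}\to\mathbf C$ such that $$\big((\widehat H_{ext}-\lambda)\widehat u\big)(n)=0\quad\text{for all } n\in\stackrel{\circ}{\Omega}_{ext}$$ and $$\lim_{R\to\infty}\frac1R\sum_{R_0<|n|<R}|\widehat u(n)|^2=0,$$ where $R_0>0$ is such that $\{n\in\mathbf Z^d:|n|>R_0\}\subset\Omega_{ext}$. Then $\widehat u=0$ on $\Omega_{ext}$.
   Context: $\mathbf Z^d$ is the square lattice with standard basis $e_1,\dots,e_d$, $|n|=(\sum_{i=1}^d n_i^2)^{1/2}$, and $$(\Delta_{disc}\widehat u)(n)=\frac14\sum_{j=1}^d\big(\widehat u(n+e_j)+\widehat u(n-e_j)\big)-\frac d2\,\widehat u(n).$$ A subset $\Omega\subset\mathbf Z^d$ is connected if for any $m,n\in\Omega$ there is a sequence $n^{(0)}=m,n^{(1)},\dots,n^{(k)}=n$ in $\Omega$ with $|n^{(\ell)}-n^{(\ell+1)}|=1$ for $0\le\ell\le k-1$. For $n\in\Omega$ put $\deg_\Omega(n)=\#\{m\in\Omega:|m-n|=1\}$. The interior and the boundary of $\Omega$ are $$\stackrel{\circ}{\Omega}=\{n\in\Omega:\deg_\Omega(n)=2d\},\qquad \partial\Omega=\{n\in\Omega:\deg_\Omega(n)<2d\}.$$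 An exterior domain is a set $\Omega_{ext}=\mathbf Z^d\setminus\stackrel{\circ}{\Omega}_{int}$ for some bounded set $\Omega_{int}\subset\mathbf Z^d$. No boundary condition is imposed on $\widehat H_{ext}$; $\widehat V$ acts by multiplication. For $1\le i\le d$ and $n\in\mathbf Z^d$ define the cones $$C_{i,\pm}(n)=\Big\{m\in\mathbf Z^d:\ \sum_{k\ne i}|m_k-n_k|\le\pm(m_i-n_i)\Big\}.$$ $\Omega_{ext}$ satisfies the cone condition if for every $n\in\Omega_{ext}$ there is a cone $C_{i,+}(n)$ or $C_{i,-}(n)$ (for some $i$) contained in $\Omega_{ext}$. *)

theory Defs
  imports "HOL-Analysis.Analysis"
begin

text \<open>
  The lattice \<open>\<int>\<^sup>d\<close> is the type \<open>int ^ 'd\<close>, with \<open>d = CARD('d)\<close> and standard basis vectors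
  \<open>axis j 1\<close>.  A function on a subset \<open>\<Omega>\<close> of the lattice is a total function whose values off \<open>\<Omega>\<close>
  are irrelevant.
\<close>

text \<open>The type \<open>int\<close> is not an instance of \<open>metric_space\<close>, so the library's \<open>norm\<close>, \<open>dist\<close> and
  \<open>bounded\<close> are unavailable on \<open>int ^ 'd\<close>.\<close>

definition lattice_norm :: "int ^ 'd \<Rightarrow> real" where
  "lattice_norm n = sqrt (\<Sum>i\<in>UNIV. (real_of_int (n $ i))\<^sup>2)"

definition lattice_connected :: "(int ^ 'd) set \<Rightarrow> bool" where
  "lattice_connected \<Omega> \<longleftrightarrow>
     (\<forall>m\<in>\<Omega>. \<forall>n\<in>\<Omega>. \<exists>(k::nat) p. p 0 = m \<and> p k = n \<and> (\<forall>l\<le>k. p l \<in> \<Omega>) \<and>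
        (\<forall>l<k. lattice_norm (p l - p (Suc l)) = 1))"

definition lattice_deg :: "(int ^ 'd) set \<Rightarrow> int ^ 'd \<Rightarrow> nat" where
  "lattice_deg \<Omega> n = card {m \<in> \<Omega>. lattice_norm (m - n) = 1}"

definition lattice_interior :: "(int ^ 'd) set \<Rightarrow> (int ^ 'd) set" where
  "lattice_interior \<Omega> = {n \<in> \<Omega>. lattice_deg \<Omega> n = 2 * CARD('d)}"

definition lattice_bounded :: "(int ^ 'd) set \<Rightarrow> bool" where
  "lattice_bounded S \<longleftrightarrow> (\<exists>B. \<forall>n\<in>S. lattice_norm n \<le> B)"

definition exterior_domain :: "(int ^ 'd) set \<Rightarrow> bool" where
  "exterior_domain \<Omega> \<longleftrightarrow> (\<exists>\<Omega>int. lattice_bounded \<Omega>int \<and> \<Omega> = UNIV - lattice_interior \<Omega>int)"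

text \<open>The parameter \<open>s\<close> is the sign of the cone, \<open>1\<close> or \<open>-1\<close>.\<close>

definition lattice_cone :: "'d \<Rightarrow> int \<Rightarrow> int ^ 'd \<Rightarrow> (int ^ 'd) set" where
  "lattice_cone i s n = {m. (\<Sum>k\<in>UNIV - {i}. \<bar>m $ k - n $ k\<bar>) \<le> s * (m $ i - n $ i)}"

definition cone_condition :: "(int ^ 'd) set \<Rightarrow> bool" where
  "cone_condition \<Omega> \<longleftrightarrow> (\<forall>n\<in>\<Omega>. \<exists>i. \<exists>s\<in>{1, -1}. lattice_cone i s n \<subseteq> \<Omega>)"

definition disc_laplacian :: "(int ^ 'd \<Rightarrow> complex) \<Rightarrow> int ^ 'd \<Rightarrow> complex" where
  "disc_laplacian u n =
     1 / 4 * (\<Sum>j\<in>UNIV. u (n + axis j 1) + u (n - axis j 1)) - of_nat CARD('d) / 2 * u n"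

text \<open>
  For \<open>u\<close> and \<open>V\<close> given on \<open>\<Omega>\<close>, the value at \<open>n\<close> is meaningful only when \<open>n\<close> lies in
  \<open>lattice_interior \<Omega>\<close>, that is, when \<open>n\<close> and all its neighbours are in \<open>\<Omega>\<close>.
\<close>

definition disc_schroedinger ::
  "(int ^ 'd \<Rightarrow> real) \<Rightarrow> (int ^ 'd \<Rightarrow> complex) \<Rightarrow> int ^ 'd \<Rightarrow> complex" where
  "disc_schroedinger V u n = - disc_laplacian u n + complex_of_real (V n) * u n"

text \<open>The compact subsets of the lattice, which is discrete, are the finite ones.\<close>

definition compactly_supported_on :: "(int ^ 'd) set \<Rightarrow> (int ^ 'd \<Rightarrow> real) \<Rightarrow> bool" where
  "compactly_supported_on \<Omega> V \<longleftrightarrow> finite {n \<in> \<Omega>. V n \<noteq> 0}"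

end

theory Submission
  imports Defs
begin

text \<open>
  Extended by zero, \<open>u\<close> solves \<open>(A - E) u = f\<close> with \<open>A\<close> the sum over nearest neighbours,
  \<open>E = 2 d - 4 \<lambda>\<close> in \<open>(-2 d, 2 d)\<close> and \<open>f\<close> finitely supported.  By Green's identity with a
  cutoff at scale \<open>R\<close>, the growth condition gives \<open>\<Sum> f v = \<Sum> u g\<close> whenever \<open>(A - E) v = g\<close> has finite
  support and the \<open>\<ell>\<^sup>2\<close> mass of \<open>v\<close> in balls of radius \<open>R\<close> is \<open>O(R)\<close>.  Fourier transform in all variables but the
  \<open>i\<close>-th turns \<open>A - E\<close> into the recurrence \<open>a (k + 1) + a (k - 1) - t a k\<close>, and by Bessel's inequality
  every family of multipliers bounded uniformly in \<open>k\<close> yields an admissible \<open>v\<close>.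

  Dividing by the symbol in the \<open>i\<close>-th variable, one subtracts a finitely supported \<open>w\<close> so that \<open>f\<close> is
  carried by two neighbouring layers.  Testing with \<open>a k = sin (k \<theta>) sin \<theta>\<close>, \<open>t = 2 cos \<theta>\<close>, shows that the
  Fourier transform of \<open>f\<close> on each layer vanishes on the open set \<open>\<bar>t\<bar> < 2\<close>, hence \<open>f = 0\<close>.  Testing with
  the central difference in direction \<open>i\<close> of the decaying Green kernel shows that \<open>u - w\<close> is 2-periodic
  in direction \<open>i\<close>, and the growth condition forces it to vanish.  So \<open>u\<close> has finite support, and the
  equation propagates zeros down each cone to its apex.
\<close>

section \<open>Norm and balls on the lattice\<close>

lemma lattice_norm_eq_norm:
  fixes n :: "int ^ 'd"
  shows "lattice_norm n = norm (\<chi> i. real_of_int (n $ i))"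
  by (simp add: lattice_norm_def norm_vec_def L2_set_def)

lemma lattice_norm_triangle:
  fixes m n :: "int ^ 'd"
  shows "lattice_norm (m + n) \<le> lattice_norm m + lattice_norm n"
proof -
  have "(\<chi> i. real_of_int ((m + n) $ i))
      = (\<chi> i. real_of_int (m $ i)) + (\<chi> i. real_of_int (n $ i))"
    by (simp add: vec_eq_iff)
  then show ?thesis
    by (metis lattice_norm_eq_norm norm_triangle_ineq)
qed

lemma lattice_norm_minus [simp]: "lattice_norm (- n) = lattice_norm n"
  by (simp add: lattice_norm_def)

lemma lattice_norm_nonneg [simp]: "0 \<le> lattice_norm n"
  by (simp add: lattice_norm_eq_norm)

lemma axis_component: "axis j (c::'a::zero) $ k = (if k = j then c else 0)"
  by (simp add: axis_def)

lemma lattice_norm_axis: "lattice_norm (axis j c) = \<bar>real_of_int c\<bar>"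
proof -
  have "(\<Sum>i\<in>UNIV. (real_of_int (axis j c $ i))\<^sup>2) = (\<Sum>i\<in>UNIV. if i = j then (real_of_int c)\<^sup>2 else 0)"
    by (intro sum.cong) (auto simp: axis_component)
  then show ?thesis
    by (simp add: lattice_norm_def)
qed

lemma component_le_lattice_norm: "\<bar>real_of_int (n $ i)\<bar> \<le> lattice_norm n"
  using component_le_norm_cart[of "\<chi> i. real_of_int (n $ i)" i]
  by (simp add: lattice_norm_eq_norm)

lemma lattice_norm_add_axis_le:
  "lattice_norm (n + axis j 1) \<le> lattice_norm n + 1"
  "lattice_norm (n - axis j 1) \<le> lattice_norm n + 1"
  using lattice_norm_triangle[of n "axis j 1"] lattice_norm_triangle[of n "- axis j 1"]
  by (simp_all add: lattice_norm_axis)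

lemma lattice_norm_add_axis_ge:
  "lattice_norm n \<le> lattice_norm (n + axis j 1) + 1"
  "lattice_norm n \<le> lattice_norm (n - axis j 1) + 1"
  using lattice_norm_add_axis_le(2)[of "n + axis j 1" j] lattice_norm_add_axis_le(1)[of "n - axis j 1" j]
  by (simp_all only: add_diff_cancel diff_add_cancel)

definition lattice_ball :: "real \<Rightarrow> (int ^ 'd) set" where
  "lattice_ball r = {n. lattice_norm n \<le> r}"

lemma finite_lattice_ball [simp]: "finite (lattice_ball r :: (int ^ 'd) set)"
proof -
  let ?A = "{- \<lceil>r\<rceil>..\<lceil>r\<rceil>}"
  have "n \<in> vec_lambda ` (PiE UNIV (\<lambda>_. ?A))" if "n \<in> lattice_ball r" for n :: "int ^ 'd"
  proof
    show "n = vec_lambda (vec_nth n)" by simp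
    have "\<bar>real_of_int (n $ i)\<bar> \<le> r" for i
      using that component_le_lattice_norm[of n i] by (simp add: lattice_ball_def)
    then have "n $ i \<in> ?A" for i
      by (smt (verit, best) atLeastAtMost_iff ceiling_correct of_int_le_iff of_int_minus)
    then show "vec_nth n \<in> PiE UNIV (\<lambda>_. ?A)" by auto
  qed
  then show ?thesis
    by (meson finite_PiE finite_atLeastAtMost_int finite_class.finite_UNIV finite_imageI finite_subset subsetI)
qed

lemma finite_imp_subset_lattice_ball:
  assumes "finite S"
  obtains r where "S \<subseteq> lattice_ball r"
proof
  show "S \<subseteq> lattice_ball (\<Sum>n\<in>S. lattice_norm n)"
    using assms by (auto simp: lattice_ball_def intro: member_le_sum)
qed

lemma lattice_ball_mono: "r \<le> s \<Longrightarrow> lattice_ball r \<subseteq> lattice_ball s"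
  by (auto simp: lattice_ball_def)

section \<open>Green's identity on the lattice\<close>

lemma sum_shift:
  fixes F :: "'a::group_add \<Rightarrow> 'b::comm_monoid_add"
  assumes "finite K" "\<And>n. F n \<noteq> 0 \<Longrightarrow> n \<in> K" "\<And>n. F (n + e) \<noteq> 0 \<Longrightarrow> n \<in> K"
  shows "(\<Sum>n\<in>K. F (n + e)) = (\<Sum>n\<in>K. F n)"
proof -
  have "(\<Sum>n\<in>K. F (n + e)) = (\<Sum>n | F (n + e) \<noteq> 0. F (n + e))"
    using assms by (intro sum.mono_neutral_right) auto
  also have "\<dots> = (\<Sum>n | F n \<noteq> 0. F n)"
    by (rule sum.reindex_bij_witness[of _ "\<lambda>n. n - e" "\<lambda>n. n + e"]) (auto simp: algebra_simps)
  also have "\<dots> = (\<Sum>n\<in>K. F n)"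
    using assms by (intro sum.mono_neutral_left) auto
  finally show ?thesis .
qed

definition nbr_sum :: "(int ^ 'd \<Rightarrow> complex) \<Rightarrow> int ^ 'd \<Rightarrow> complex" where
  "nbr_sum u n = (\<Sum>j\<in>UNIV. u (n + axis j 1) + u (n - axis j 1))"

definition helmholtz :: "real \<Rightarrow> (int ^ 'd \<Rightarrow> complex) \<Rightarrow> int ^ 'd \<Rightarrow> complex" where
  "helmholtz E u n = nbr_sum u n - of_real E * u n"

definition sublinear_growth :: "(int ^ 'd \<Rightarrow> complex) \<Rightarrow> bool" where
  "sublinear_growth u \<longleftrightarrow> (\<forall>\<epsilon>>0. \<exists>r0. \<forall>r\<ge>r0. (\<Sum>n\<in>lattice_ball r. (cmod (u n))\<^sup>2) \<le> \<epsilon> * r)"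

text \<open>Dual to \<open>sublinear_growth\<close>: by Cauchy-Schwarz the sum of |u| |v| over a
  ball of radius r is o(r), which a cutoff of slope 1 / r turns into o(1).\<close>

definition linear_growth :: "(int ^ 'd \<Rightarrow> complex) \<Rightarrow> bool" where
  "linear_growth v \<longleftrightarrow> (\<exists>C\<ge>0. \<forall>r\<ge>1. (\<Sum>n\<in>lattice_ball r. (cmod (v n))\<^sup>2) \<le> C * r)"

lemma sum_mult_le_L2:
  fixes u v :: "'a \<Rightarrow> complex"
  assumes "(\<Sum>n\<in>K. (cmod (u n))\<^sup>2) \<le> a" "(\<Sum>n\<in>K. (cmod (v n))\<^sup>2) \<le> b"
  shows "(\<Sum>n\<in>K. cmod (u n) * cmod (v n)) \<le> sqrt a * sqrt b"
proof -
  have "(\<Sum>n\<in>K. cmod (u n) * cmod (v n)) \<le> L2_set (\<lambda>n. cmod (u n)) K * L2_set (\<lambda>n. cmod (v n)) K"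
    using L2_set_mult_ineq[of "\<lambda>n. cmod (u n)" "\<lambda>n. cmod (v n)" K] by simp
  also have "\<dots> \<le> sqrt a * sqrt b"
    unfolding L2_set_def
    by (intro mult_mono real_sqrt_le_mono assms)
       (auto intro!: sum_nonneg order_trans[OF sum_nonneg assms(1)])
  finally show ?thesis .
qed

text \<open>Summation by parts in the direction \<open>e\<close>: translating the terms
  \<open>u n * v (n \<plusminus> e)\<close> moves all differences onto the cutoff \<open>c\<close>,
  so only the region where \<open>c\<close> varies contributes.\<close>

lemma sum_cutoff_edge:
  fixes u v :: "int ^ 'd \<Rightarrow> complex" and c :: "int ^ 'd \<Rightarrow> real"
  assumes K: "finite K" and supp: "\<And>n. c n \<noteq> 0 \<Longrightarrow> n \<in> K \<and> n + e \<in> K \<and> n - e \<in> K"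
  shows "(\<Sum>n\<in>K. c n * ((u (n + e) + u (n - e)) * v n - u n * (v (n + e) + v (n - e))))
       = (\<Sum>n\<in>K. (c n - c (n + e)) * (u (n + e) * v n) + (c n - c (n - e)) * (u (n - e) * v n))"
proof -
  have "(\<Sum>n\<in>K. c (n + e) * u (n + e) * v (n + e + - e)) = (\<Sum>n\<in>K. c n * u n * v (n + - e))"
    by (rule sum_shift[of K "\<lambda>n. c n * u n * v (n + - e)"]) (use K in \<open>auto dest: supp\<close>)
  moreover have "(\<Sum>n\<in>K. c (n + - e) * u (n + - e) * v (n + - e + e)) = (\<Sum>n\<in>K. c n * u n * v (n + e))"
    by (rule sum_shift[of K "\<lambda>n. c n * u n * v (n + e)"]) (use K in \<open>auto dest: supp\<close>)
  ultimately show ?thesis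
    by (simp add: algebra_simps sum.distrib sum_subtractf)
qed

lemma helmholtz_skew_eq:
  "helmholtz E u n * v n - u n * helmholtz E v n
     = (\<Sum>j\<in>UNIV. (u (n + axis j 1) + u (n - axis j 1)) * v n
         - u n * (v (n + axis j 1) + v (n - axis j 1)))"
  by (simp add: helmholtz_def nbr_sum_def sum_subtractf sum_distrib_left sum_distrib_right algebra_simps)

lemma sum_shift_le:
  fixes h :: "int ^ 'd \<Rightarrow> real"
  assumes "\<And>n. 0 \<le> h n" "\<And>n. lattice_norm (n + e) \<le> lattice_norm n + 1"
  shows "(\<Sum>n\<in>lattice_ball r. h (n + e)) \<le> (\<Sum>n\<in>lattice_ball (r + 1). h n)"
proof -
  have "(\<Sum>n\<in>lattice_ball r. h (n + e)) = (\<Sum>n\<in>(\<lambda>n. n + e) ` lattice_ball r. h n)"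
    by (subst sum.reindex) auto
  also have "\<dots> \<le> (\<Sum>n\<in>lattice_ball (r + 1). h n)"
  proof (intro sum_mono2)
    show "(\<lambda>n. n + e) ` lattice_ball r \<subseteq> lattice_ball (r + 1)"
    proof
      fix m assume "m \<in> (\<lambda>n. n + e) ` lattice_ball r"
      then show "m \<in> lattice_ball (r + 1)"
        using assms(2)[of "m - e"] by (auto simp: lattice_ball_def)
    qed
  qed (use assms in auto)
  finally show ?thesis .
qed

text \<open>With a cutoff of slope 1 / R the edge terms are at most 1 / R times sums of |u| |v| over
  a ball of radius O(R). These sums are o(R), so the edge terms tend to 0.\<close>

lemma green_identity:
  fixes u v :: "int ^ 'd \<Rightarrow> complex"
  assumes u: "sublinear_growth u" and v: "linear_growth v" and F: "finite F"
    and uF: "\<And>n. n \<notin> F \<Longrightarrow> helmholtz E u n = 0" and vF: "\<And>n. n \<notin> F \<Longrightarrow> helmholtz E v n = 0"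
  shows "(\<Sum>n\<in>F. helmholtz E u n * v n) = (\<Sum>n\<in>F. u n * helmholtz E v n)"
proof -
  define X where "X = (\<Sum>n\<in>F. helmholtz E u n * v n - u n * helmholtz E v n)"
  obtain r1 where r1: "F \<subseteq> lattice_ball r1"
    using finite_imp_subset_lattice_ball[OF F] .
  obtain C where C: "C \<ge> 0" "\<And>r. r \<ge> 1 \<Longrightarrow> (\<Sum>n\<in>lattice_ball r. (cmod (v n))\<^sup>2) \<le> C * r"
    using v by (auto simp: linear_growth_def)
  \<comment> \<open>Each of the d directions has two edge terms, each at most
    \<open>1 / R * (4 * R * (\<delta> * sqrt C))\<close>.\<close>
  define D where "D = 8 * real CARD('d) * sqrt C"
  have D: "D \<ge> 0" using C by (simp add: D_def)
  have bound: "cmod X \<le> D * \<delta>" if "\<delta> > 0" for \<delta>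
  proof -
    obtain r0 where r0: "\<And>r. r \<ge> r0 \<Longrightarrow> (\<Sum>n\<in>lattice_ball r. (cmod (u n))\<^sup>2) \<le> \<delta>\<^sup>2 * r"
      using u[unfolded sublinear_growth_def, rule_format, OF zero_less_power[OF \<open>\<delta> > 0\<close>]] by blast
    define R where "R = max 1 (max r1 r0)"
    have R: "R \<ge> 1" "R \<ge> r1" "R \<ge> r0" by (auto simp: R_def)
    \<comment> \<open>The cutoff is 1 on the ball of radius R, which contains \<open>F\<close>, and
      vanishes outside radius 2 R; the extra 1 in \<open>K\<close> makes room for the neighbours of
      its support.\<close>
    define c where "c n = max 0 (min 1 (2 - lattice_norm n / R))" for n :: "int ^ 'd"
    define K :: "(int ^ 'd) set" where "K = lattice_ball (2 * R + 1)"
    have K: "finite K" by (simp add: K_def)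
    have supp: "n \<in> K \<and> n + axis j 1 \<in> K \<and> n - axis j 1 \<in> K" if "c n \<noteq> 0" for n j
    proof -
      have "lattice_norm n < 2 * R"
        using that R by (auto simp: c_def max_def min_def field_simps split: if_splits)
      then show ?thesis
        using lattice_norm_add_axis_le[of n j] R by (auto simp: K_def lattice_ball_def)
    qed
    have lip: "\<bar>c n - c m\<bar> \<le> 1 / R"
      if "lattice_norm n \<le> lattice_norm m + 1" "lattice_norm m \<le> lattice_norm n + 1" for n m
    proof -
      have "\<bar>c n - c m\<bar> \<le> \<bar>lattice_norm n / R - lattice_norm m / R\<bar>"
        unfolding c_def by linarith
      also have "\<dots> = \<bar>lattice_norm n - lattice_norm m\<bar> / R"
        using R by (simp add: diff_divide_distrib[symmetric])
      also have "\<dots> \<le> 1 / R"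
        using R that by (intro divide_right_mono) auto
      finally show ?thesis .
    qed
    have c1: "c n = 1" if "n \<in> F" for n
    proof -
      have "lattice_norm n \<le> R" using r1 that R by (auto simp: lattice_ball_def)
      then have "lattice_norm n / R \<le> 1" using R by simp
      then show ?thesis by (simp add: c_def)
    qed
    have "F \<subseteq> K"
      using r1 R lattice_ball_mono[of r1 "2 * R + 1"] by (auto simp: K_def)
    have "X = (\<Sum>n\<in>F. c n * (helmholtz E u n * v n - u n * helmholtz E v n))"
      unfolding X_def using c1 by (intro sum.cong) auto
    also have "\<dots> = (\<Sum>n\<in>K. c n * (helmholtz E u n * v n - u n * helmholtz E v n))"
      using \<open>F \<subseteq> K\<close> K uF vF by (intro sum.mono_neutral_left) auto
    also have "\<dots> = (\<Sum>j\<in>UNIV. \<Sum>n\<in>K. c n * ((u (n + axis j 1) + u (n - axis j 1)) * v n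
         - u n * (v (n + axis j 1) + v (n - axis j 1))))"
      unfolding helmholtz_skew_eq sum_distrib_left by (rule sum.swap)
    also have "\<dots> = (\<Sum>j\<in>UNIV. \<Sum>n\<in>K. (c n - c (n + axis j 1)) * (u (n + axis j 1) * v n)
         + (c n - c (n - axis j 1)) * (u (n - axis j 1) * v n))"
      by (intro sum.cong refl sum_cutoff_edge K supp)
    finally have X: "X = \<dots>" .
    \<comment> \<open>Shifting by one step enlarges the radius to 2 R + 2, which is at most 4 R
      since R is at least 1.\<close>
    have UK: "(\<Sum>n\<in>K. (cmod (u (n + e)))\<^sup>2) \<le> 4 * R * \<delta>\<^sup>2"
      if "\<And>n. lattice_norm (n + e) \<le> lattice_norm n + 1" for e
    proof -
      have "(\<Sum>n\<in>K. (cmod (u (n + e)))\<^sup>2) \<le> (\<Sum>n\<in>lattice_ball (2 * R + 1 + 1). (cmod (u n))\<^sup>2)"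
        unfolding K_def using that by (intro sum_shift_le[of "\<lambda>n. (cmod (u n))\<^sup>2"]) auto
      also have "\<dots> \<le> \<delta>\<^sup>2 * (2 * R + 1 + 1)" using R by (intro r0) auto
      also have "\<dots> \<le> \<delta>\<^sup>2 * (4 * R)" using R by (intro mult_left_mono) auto
      finally show ?thesis by (simp add: mult.commute)
    qed
    have VK: "(\<Sum>n\<in>K. (cmod (v n))\<^sup>2) \<le> 4 * R * C"
    proof -
      have "(\<Sum>n\<in>K. (cmod (v n))\<^sup>2) \<le> C * (2 * R + 1)" unfolding K_def using R by (intro C) auto
      also have "\<dots> \<le> C * (4 * R)" using R C by (intro mult_left_mono) auto
      finally show ?thesis by (simp add: mult.commute)
    qed
    have UV: "(\<Sum>n\<in>K. cmod (u (n + e)) * cmod (v n)) \<le> 4 * R * (\<delta> * sqrt C)"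
      if "\<And>n. lattice_norm (n + e) \<le> lattice_norm n + 1" for e
    proof -
      have "(\<Sum>n\<in>K. cmod (u (n + e)) * cmod (v n)) \<le> sqrt (4 * R * \<delta>\<^sup>2) * sqrt (4 * R * C)"
        by (intro sum_mult_le_L2 UK that VK)
      also have "\<dots> = (sqrt (4 * R) * sqrt (4 * R)) * (\<delta> * sqrt C)"
        using \<open>\<delta> > 0\<close> by (simp add: real_sqrt_mult mult_ac)
      also have "\<dots> = 4 * R * (\<delta> * sqrt C)"
        using R by simp
      finally show ?thesis .
    qed
    have "cmod X \<le> (\<Sum>j\<in>(UNIV :: 'd set). \<Sum>n\<in>K. 1 / R * (cmod (u (n + axis j 1)) * cmod (v n))
         + 1 / R * (cmod (u (n + - axis j 1)) * cmod (v n)))"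
      unfolding X
    proof (intro order_trans[OF norm_sum] sum_mono order_trans[OF norm_triangle_ineq] add_mono)
      fix j :: 'd and n :: "int ^ 'd"
      show "cmod ((c n - c (n + axis j 1)) * (u (n + axis j 1) * v n))
        \<le> 1 / R * (cmod (u (n + axis j 1)) * cmod (v n))"
        unfolding norm_mult norm_of_real of_real_diff[symmetric]
        using lattice_norm_add_axis_le[of n j] lattice_norm_add_axis_ge[of n j]
        by (intro mult_right_mono lip) auto
      show "cmod ((c n - c (n - axis j 1)) * (u (n - axis j 1) * v n))
        \<le> 1 / R * (cmod (u (n + - axis j 1)) * cmod (v n))"
        unfolding norm_mult norm_of_real of_real_diff[symmetric] add_uminus_conv_diff
        using lattice_norm_add_axis_le[of n j] lattice_norm_add_axis_ge[of n j]
        by (intro mult_right_mono lip) auto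
    qed
    also have "\<dots> \<le> (\<Sum>j\<in>(UNIV :: 'd set). 1 / R * (4 * R * (\<delta> * sqrt C)) + 1 / R * (4 * R * (\<delta> * sqrt C)))"
    proof (rule sum_mono)
      fix j :: 'd
      show "(\<Sum>n\<in>K. 1 / R * (cmod (u (n + axis j 1)) * cmod (v n)) + 1 / R * (cmod (u (n + - axis j 1)) * cmod (v n)))
          \<le> 1 / R * (4 * R * (\<delta> * sqrt C)) + 1 / R * (4 * R * (\<delta> * sqrt C))"
        unfolding sum.distrib sum_distrib_left[symmetric]
        by (intro add_mono mult_left_mono UV) (use R in \<open>auto simp: lattice_norm_add_axis_le\<close>)
    qed
    also have "\<dots> = D * \<delta>"
      using R by (simp add: D_def)
    finally show ?thesis .
  qed
  have "cmod X \<le> 0"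
  proof (rule ccontr)
    assume "\<not> cmod X \<le> 0"
    then have pos: "cmod X > 0" by simp
    \<comment> \<open>The bound holds for every positive \<open>\<delta>\<close>; dividing by
      \<open>D + 1\<close> also covers \<open>D = 0\<close>.\<close>
    have "cmod X \<le> D * (cmod X / (D + 1))"
      using bound[of "cmod X / (D + 1)"] pos D by simp
    then have "cmod X * (D + 1) \<le> D * cmod X"
      using D by (simp add: field_simps)
    then show False using pos by (simp add: algebra_simps)
  qed
  then show ?thesis by (simp add: X_def sum_subtractf)
qed

section \<open>Vanishing lemmas on the lattice\<close>

text \<open>A nonzero value recurs at every second point of a line, so the mass in balls would grow
  at least linearly.\<close>

lemma periodic_sublinear_growth_eq_0:
  fixes u :: "int ^ 'd \<Rightarrow> complex"
  assumes u: "sublinear_growth u" and per: "\<And>n. u (n + axis i 1) = u (n - axis i 1)"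
  shows "u n = 0"
proof (rule ccontr)
  assume "u n \<noteq> 0"
  define s where "s = (cmod (u n))\<^sup>2"
  have s: "s > 0" using \<open>u n \<noteq> 0\<close> by (simp add: s_def)
  define p where "p k = n + axis i (2 * int k)" for k
  have pS: "p (Suc k) = p k + axis i 1 + axis i 1" for k
    by (auto simp: p_def vec_eq_iff axis_component)
  have up: "u (p k) = u n" for k
  proof (induction k)
    case 0
    have "p 0 = n" by (simp add: p_def vec_eq_iff axis_component)
    then show ?case by simp
  next
    case (Suc k)
    then show ?case
      using per[of "p k + axis i 1"] by (simp add: pS)
  qed
  have inj: "inj p"
    by (rule injI) (auto simp: p_def axis_eq_axis)
  \<comment> \<open>The ball of radius |n| + 2 N contains the N + 1 points \<open>p 0\<close>, ...,
    \<open>p N\<close>. Once N is at least |n|, the factor 1 / 4 allows them a total mass of at most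
    3 N s / 4, less than (N + 1) s.\<close>
  obtain r0 where r0: "\<And>r. r \<ge> r0 \<Longrightarrow> (\<Sum>n\<in>lattice_ball r. (cmod (u n))\<^sup>2) \<le> s / 4 * r"
    using u s unfolding sublinear_growth_def by (metis divide_pos_pos zero_less_numeral)
  obtain N :: nat where N: "real N \<ge> max r0 (lattice_norm n)"
    using real_arch_simple by blast
  let ?r = "lattice_norm n + 2 * real N"
  have sub: "p ` {..N} \<subseteq> lattice_ball ?r"
  proof
    fix m assume "m \<in> p ` {..N}"
    then obtain k where k: "m = p k" "k \<le> N" by auto
    have "lattice_norm m \<le> lattice_norm n + 2 * real k"
      using lattice_norm_triangle[of n "axis i (2 * int k)"] k by (simp add: p_def lattice_norm_axis)
    then show "m \<in> lattice_ball ?r"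
      using k by (simp add: lattice_ball_def)
  qed
  have "real (N + 1) * s = (\<Sum>m\<in>p ` {..N}. (cmod (u m))\<^sup>2)"
    by (subst sum.reindex) (use inj in \<open>auto simp: inj_on_def inj_def up s_def\<close>)
  also have "\<dots> \<le> (\<Sum>m\<in>lattice_ball ?r. (cmod (u m))\<^sup>2)"
    using sub by (intro sum_mono2) auto
  also have "\<dots> \<le> s / 4 * ?r"
    using N by (intro r0) (simp add: add_increasing)
  also have "\<dots> = s * (?r / 4)" by simp
  finally have "real (N + 1) \<le> ?r / 4"
    using s by (simp add: mult.commute)
  then show False using N by simp
qed

section \<open>Finitely supported functions and division by the symbol\<close>

lemma finite_helmholtz:
  fixes w :: "int ^ 'd \<Rightarrow> complex"
  assumes "finite {n. w n \<noteq> 0}"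
  shows "finite {n. helmholtz E w n \<noteq> 0}"
proof (rule finite_subset)
  let ?S = "{n. w n \<noteq> 0}"
  let ?T = "?S \<union> (\<Union>j. (\<lambda>n. n - axis j 1) ` ?S \<union> (\<lambda>n. n + axis j 1) ` ?S)"
  show "finite ?T" using assms by auto
  show "{n. helmholtz E w n \<noteq> 0} \<subseteq> ?T"
  proof
    fix n assume n: "n \<in> {n. helmholtz E w n \<noteq> 0}"
    show "n \<in> ?T"
    proof (rule ccontr)
      assume no: "n \<notin> ?T"
      have "w (n + axis j 1) = 0" for j
        using no by (force simp: image_iff)
      moreover have "w (n - axis j 1) = 0" for j
        using no by (force simp: image_iff)
      ultimately have "helmholtz E w n = 0" using no by (simp add: helmholtz_def nbr_sum_def)
      with n show False by simp
    qed
  qed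
qed

lemma helmholtz_add: "helmholtz E (\<lambda>n. f n + g n) n = helmholtz E f n + helmholtz E g n"
  by (simp add: helmholtz_def nbr_sum_def sum.distrib algebra_simps)

lemma helmholtz_diff: "helmholtz E (\<lambda>n. f n - g n) n = helmholtz E f n - helmholtz E g n"
  by (simp add: helmholtz_def nbr_sum_def sum.distrib sum_subtractf algebra_simps)

lemma helmholtz_split:
  "helmholtz E u n = u (n + axis i 1) + u (n - axis i 1)
     + (\<Sum>j\<in>UNIV - {i}. u (n + axis j 1) + u (n - axis j 1)) - of_real E * u n"
  by (simp add: helmholtz_def nbr_sum_def sum.remove[of UNIV i])

text \<open>Polynomial division: as a Laurent polynomial in the \<open>i\<close>-th variable the symbol of
  \<open>helmholtz E\<close> is monic of span two, so a finitely supported \<open>f\<close> has a remainder living on two layers.\<close>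

lemma helmholtz_division:
  fixes f :: "int ^ 'd \<Rightarrow> complex"
  assumes "finite {n. f n \<noteq> 0}" "\<And>n. f n \<noteq> 0 \<Longrightarrow> a \<le> n $ i \<and> n $ i \<le> a + 1 + int m"
  shows "\<exists>w. finite {n. w n \<noteq> 0} \<and> (\<forall>n. f n - helmholtz E w n \<noteq> 0 \<longrightarrow> n $ i \<in> {a, a + 1})"
  using assms
proof (induction m arbitrary: f)
  case 0
  have "helmholtz E (\<lambda>_. 0) n = 0" for n :: "int ^ 'd" by (simp add: helmholtz_def nbr_sum_def)
  then show ?case using 0 by (intro exI[of _ "\<lambda>_. 0"]) force
next
  case (Suc m)
  \<comment> \<open>The top layer that \<open>f\<close> can occupy is \<open>k + 1\<close>. Copied
    one layer down as \<open>w0\<close>, it is reproduced there by \<open>helmholtz E w0\<close>,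
    which otherwise touches only the layers \<open>k\<close> and \<open>k - 1\<close>, both in the
    smaller range.\<close>
  define k where "k = a + 1 + int m"
  define w0 where "w0 n = (if n $ i = k then f (n + axis i 1) else 0)" for n
  have "{n. w0 n \<noteq> 0} \<subseteq> (\<lambda>n. n - axis i 1) ` {n. f n \<noteq> 0}"
    by (force simp: w0_def image_iff split: if_splits)
  then have fin0: "finite {n. w0 n \<noteq> 0}"
    using Suc.prems(1) finite_surj by blast
  define f1 where "f1 n = f n - helmholtz E w0 n" for n
  have "{n. f1 n \<noteq> 0} \<subseteq> {n. f n \<noteq> 0} \<union> {n. helmholtz E w0 n \<noteq> 0}"
    by (auto simp: f1_def)
  then have "finite {n. f1 n \<noteq> 0}"
    using Suc.prems(1) finite_helmholtz[OF fin0] finite_subset by blast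
  moreover have "a \<le> n $ i \<and> n $ i \<le> a + 1 + int m" if "f1 n \<noteq> 0" for n
  proof (rule ccontr)
    assume no: "\<not> ?thesis"
    have off: "(\<Sum>j\<in>UNIV - {i}. w0 (n + axis j 1) + w0 (n - axis j 1)) = 0"
      using no by (intro sum.neutral) (auto simp: w0_def axis_component k_def)
    show False
    proof (cases "n $ i = k + 1")
      case True
      then have "helmholtz E w0 n = f n"
        unfolding helmholtz_split[of _ _ _ i] off by (simp add: w0_def axis_component)
      then show False using that by (simp add: f1_def)
    next
      case False
      then have "f n = 0" using Suc.prems(2)[of n] no by (force simp: k_def)
      moreover have "helmholtz E w0 n = 0"
        unfolding helmholtz_split[of _ _ _ i] off using no False by (auto simp: w0_def axis_component k_def)
      ultimately show False using that by (simp add: f1_def)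
    qed
  qed
  ultimately obtain w1 where w1: "finite {n. w1 n \<noteq> 0}"
      "\<And>n. f1 n - helmholtz E w1 n \<noteq> 0 \<Longrightarrow> n $ i \<in> {a, a + 1}"
    using Suc.IH[of f1] by blast
  have "{n. w0 n + w1 n \<noteq> 0} \<subseteq> {n. w0 n \<noteq> 0} \<union> {n. w1 n \<noteq> 0}" by auto
  then have "finite {n. w0 n + w1 n \<noteq> 0}"
    using fin0 w1(1) finite_subset by blast
  moreover have "f n - helmholtz E (\<lambda>n. w0 n + w1 n) n = f1 n - helmholtz E w1 n" for n
    by (simp add: f1_def helmholtz_add)
  ultimately show ?case
    using w1(2) by (intro exI[of _ "\<lambda>n. w0 n + w1 n"]) auto
qed

lemma sublinear_growth_diff_finite:
  fixes u w :: "int ^ 'd \<Rightarrow> complex"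
  assumes u: "sublinear_growth u" and w: "finite {n. w n \<noteq> 0}"
  shows "sublinear_growth (\<lambda>n. u n - w n)"
  unfolding sublinear_growth_def
proof (intro allI impI)
  fix \<epsilon> :: real assume "\<epsilon> > 0"
  then obtain r0 where r0: "\<And>r. r \<ge> r0 \<Longrightarrow> (\<Sum>n\<in>lattice_ball r. (cmod (u n))\<^sup>2) \<le> \<epsilon> / 4 * r"
    using u unfolding sublinear_growth_def by (metis divide_pos_pos zero_less_numeral)
  define W where "W = (\<Sum>n | w n \<noteq> 0. (cmod (w n))\<^sup>2)"
  show "\<exists>r0. \<forall>r\<ge>r0. (\<Sum>n\<in>lattice_ball r. (cmod (u n - w n))\<^sup>2) \<le> \<epsilon> * r"
  proof (intro exI allI impI)
    \<comment> \<open>Beyond this threshold \<open>2 * W\<close> is at most half of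
      \<open>\<epsilon> * r\<close>; the other half bounds the contribution of
      \<open>u\<close>.\<close>
    fix r assume r: "r \<ge> max r0 (4 * W / \<epsilon>)"
    have "(\<Sum>n\<in>lattice_ball r. (cmod (w n))\<^sup>2) = (\<Sum>n \<in> lattice_ball r \<inter> {n. w n \<noteq> 0}. (cmod (w n))\<^sup>2)"
      by (intro sum.mono_neutral_right) auto
    also have "\<dots> \<le> W"
      unfolding W_def using w by (intro sum_mono2) auto
    finally have W: "(\<Sum>n\<in>lattice_ball r. (cmod (w n))\<^sup>2) \<le> W" .
    have "(cmod (u n - w n))\<^sup>2 \<le> 2 * (cmod (u n))\<^sup>2 + 2 * (cmod (w n))\<^sup>2" for n
    proof -
      have "(cmod (u n - w n))\<^sup>2 \<le> (cmod (u n) + cmod (w n))\<^sup>2"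
        by (intro power_mono norm_triangle_ineq4) auto
      also have "\<dots> \<le> 2 * (cmod (u n))\<^sup>2 + 2 * (cmod (w n))\<^sup>2"
        using sum_squares_bound[of "cmod (u n)" "cmod (w n)"] by (simp add: power2_sum)
      finally show ?thesis .
    qed
    then have "(\<Sum>n\<in>lattice_ball r. (cmod (u n - w n))\<^sup>2)
        \<le> 2 * (\<Sum>n\<in>lattice_ball r. (cmod (u n))\<^sup>2) + 2 * (\<Sum>n\<in>lattice_ball r. (cmod (w n))\<^sup>2)"
      unfolding sum_distrib_left sum.distrib[symmetric] by (intro sum_mono)
    also have "\<dots> \<le> 2 * (\<epsilon> / 4 * r) + 2 * W"
      using r0[of r] W r by simp
    also have "\<dots> \<le> \<epsilon> * r"
      using r \<open>\<epsilon> > 0\<close> by (simp add: field_simps)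
    finally show "(\<Sum>n\<in>lattice_ball r. (cmod (u n - w n))\<^sup>2) \<le> \<epsilon> * r" .
  qed
qed

section \<open>Nearest neighbours and propagation of zeros in cones\<close>

lemma lattice_norm_eq_1:
  fixes x :: "int ^ 'd"
  assumes "lattice_norm x = 1"
  obtains j s where "s \<in> {1, -1}" "x = axis j s"
proof -
  have "(\<Sum>i\<in>UNIV. (real_of_int (x $ i))\<^sup>2) = 1"
    using assms by (simp add: lattice_norm_def)
  then have "real_of_int (\<Sum>i\<in>UNIV. (x $ i)\<^sup>2) = real_of_int 1" by simp
  then have sq: "(\<Sum>i\<in>UNIV. (x $ i)\<^sup>2) = 1" by (simp only: of_int_eq_iff)
  then obtain j where j: "x $ j \<noteq> 0"
    by (metis (no_types, lifting) sum.neutral power_zero_numeral zero_neq_one)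
  have rest: "(x $ j)\<^sup>2 + (\<Sum>i\<in>UNIV - {j}. (x $ i)\<^sup>2) = 1"
    using sq by (simp add: sum.remove[of UNIV j])
  have "(x $ j)\<^sup>2 \<ge> 1"
    using j by (metis int_one_le_iff_zero_less zero_less_power2)
  moreover have "(\<Sum>i\<in>UNIV - {j}. (x $ i)\<^sup>2) \<ge> 0" by (intro sum_nonneg) auto
  ultimately have "(x $ j)\<^sup>2 = 1" and z: "(\<Sum>i\<in>UNIV - {j}. (x $ i)\<^sup>2) = 0"
    using rest by auto
  then have "x $ j \<in> {1, -1}" by (simp add: power2_eq_1_iff)
  moreover have "x $ i = 0" if "i \<noteq> j" for i
    using z that by (simp add: sum_nonneg_eq_0_iff)
  then have "x = axis j (x $ j)"
    by (auto simp: vec_eq_iff axis_component)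
  ultimately show ?thesis using that by blast
qed

lemma lattice_interiorI:
  fixes n :: "int ^ 'd"
  assumes n: "n \<in> \<Omega>" and nb: "\<And>j. n + axis j 1 \<in> \<Omega>" "\<And>j. n - axis j 1 \<in> \<Omega>"
  shows "n \<in> lattice_interior \<Omega>"
proof -
  let ?g = "\<lambda>(j :: 'd, s :: int). n + axis j s"
  have neg: "n + axis j (-1) = n - axis j 1" for j
    by (auto simp: vec_eq_iff axis_component)
  have "{m \<in> \<Omega>. lattice_norm (m - n) = 1} = ?g ` (UNIV \<times> {1, -1})" (is "?L = ?R")
  proof
    show "?L \<subseteq> ?R"
    proof
      fix m assume "m \<in> ?L"
      then obtain j s where "s \<in> {1, -1}" "m - n = axis j s"
        using lattice_norm_eq_1 by blast
      then have "m = ?g (j, s)" by (metis add.commute case_prod_conv diff_add_cancel)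
      then show "m \<in> ?R" using \<open>s \<in> {1, -1}\<close> by blast
    qed
    show "?R \<subseteq> ?L"
      using nb by (auto simp: lattice_norm_axis neg)
  qed
  moreover have "inj_on ?g (UNIV \<times> {1, -1})"
    by (auto simp: inj_on_def vec_eq_iff axis_component split: if_splits)
  then have "card (?g ` (UNIV \<times> {1, -1})) = card ((UNIV :: 'd set) \<times> {1, -1 :: int})"
    by (rule card_image)
  ultimately have "lattice_deg \<Omega> n = 2 * CARD('d)"
    by (simp add: lattice_deg_def card_cartesian_product)
  then show ?thesis using n by (simp add: lattice_interior_def)
qed

text \<open>A step along the axis of the cone gains one unit of slack, which is what a unit sideways
  step can use up.\<close>

lemma lattice_cone_step:
  fixes m n :: "int ^ 'd"
  assumes m: "m \<in> lattice_cone i s n" and s: "s \<in> {1, -1}"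
  shows "m + axis i s \<in> lattice_cone i s n"
    and "\<bar>t\<bar> \<le> 1 \<Longrightarrow> j \<noteq> i \<Longrightarrow> m + axis i s + axis j t \<in> lattice_cone i s n"
proof -
  have ss: "s * s = 1" using s by auto
  have eq: "s * (m $ i + s - n $ i) = s * (m $ i - n $ i) + 1"
    using ss by (simp add: algebra_simps)
  have "(\<Sum>k\<in>UNIV - {i}. \<bar>(m + axis i s) $ k - n $ k\<bar>) = (\<Sum>k\<in>UNIV - {i}. \<bar>m $ k - n $ k\<bar>)"
    by (intro sum.cong) (auto simp: axis_component)
  then show "m + axis i s \<in> lattice_cone i s n"
    using m eq by (simp add: lattice_cone_def axis_component)
  assume t: "\<bar>t\<bar> \<le> 1" and j: "j \<noteq> i"
  have "(\<Sum>k\<in>UNIV - {i}. \<bar>(m + axis i s + axis j t) $ k - n $ k\<bar>)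
      \<le> (\<Sum>k\<in>UNIV - {i}. \<bar>m $ k - n $ k\<bar> + (if k = j then 1 else 0))"
    using t by (intro sum_mono) (auto simp: axis_component)
  also have "\<dots> = (\<Sum>k\<in>UNIV - {i}. \<bar>m $ k - n $ k\<bar>) + 1"
    using j by (simp add: sum.distrib)
  finally show "m + axis i s + axis j t \<in> lattice_cone i s n"
    using m eq j by (simp add: lattice_cone_def axis_component)
qed

text \<open>Far along the cone \<open>u\<close> vanishes. All neighbours of
  \<open>m + axis i s\<close> lie in the cone, and all but \<open>m\<close> lie on layers at least
  one step further along the axis than \<open>m\<close>; the equation there thus carries zeros back
  one layer at a time. Since \<open>eq\<close> is applied only at zeros of \<open>u\<close>, energy
  and potential terms have dropped out.\<close>

lemma cone_unique_continuation:
  fixes u :: "int ^ 'd \<Rightarrow> complex"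
  assumes cone: "lattice_cone i s n \<subseteq> \<Omega>" and s: "s \<in> {1, -1}"
    and fin: "finite {m \<in> \<Omega>. u m \<noteq> 0}"
    and eq: "\<And>m. m \<in> lattice_interior \<Omega> \<Longrightarrow> u m = 0 \<Longrightarrow> nbr_sum u m = 0"
  shows "u n = 0"
proof -
  \<comment> \<open>One more than every height \<open>s * m $ i\<close> reached by the support;
    inserting 0 gives the maximum a meaning when the support is empty.\<close>
  define M where "M = Max (insert 0 ((\<lambda>m. s * m $ i) ` {m \<in> \<Omega>. u m \<noteq> 0})) + 1"
  have ss: "s * s = 1" using s by auto
  have M: "u m = 0" if "m \<in> \<Omega>" "s * m $ i \<ge> M" for m
  proof (rule ccontr)
    assume "u m \<noteq> 0"
    then have "s * m $ i \<le> M - 1"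
      unfolding M_def using fin that by (simp, intro Max_ge) auto
    then show False using that by simp
  qed
  have "\<forall>m\<in>lattice_cone i s n. s * m $ i \<ge> M - int N \<longrightarrow> u m = 0" for N
  proof (induction N)
    case 0
    then show ?case using M cone by auto
  next
    case (Suc N)
    show ?case
    proof (intro ballI impI)
      fix m assume m: "m \<in> lattice_cone i s n" and sm: "s * m $ i \<ge> M - int (Suc N)"
      let ?m = "m + axis i s"
      have m1: "?m \<in> lattice_cone i s n" using lattice_cone_step(1)[OF m s] .
      have m2: "?m + axis i s \<in> lattice_cone i s n" using lattice_cone_step(1)[OF m1 s] .
      have nb: "?m + axis j 1 \<in> lattice_cone i s n" "?m - axis j 1 \<in> lattice_cone i s n"
        if "j \<noteq> i" for j
      proof -
        have "?m + axis j (-1) = ?m - axis j 1" by (auto simp: vec_eq_iff axis_component)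
        then show "?m + axis j 1 \<in> lattice_cone i s n" "?m - axis j 1 \<in> lattice_cone i s n"
          using lattice_cone_step(2)[OF m s, of 1 j] lattice_cone_step(2)[OF m s, of "-1" j] that
          by simp_all
      qed
      \<comment> \<open>Along the axis the neighbours of \<open>?m\<close> are \<open>m\<close> and
        the next point of the cone; the sign \<open>s\<close> decides which is which.\<close>
      have nbi: "?m + axis i 1 = ?m + axis i s \<and> ?m - axis i 1 = m \<or>
                 ?m + axis i 1 = m \<and> ?m - axis i 1 = ?m + axis i s"
        using s by (auto simp: vec_eq_iff axis_component)
      have "?m \<in> lattice_interior \<Omega>"
      proof (rule lattice_interiorI)
        show "?m \<in> \<Omega>" using m1 cone by auto
        have "?m + axis i 1 \<in> \<Omega>" "?m - axis i 1 \<in> \<Omega>"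
          using nbi subsetD[OF cone m] subsetD[OF cone m2] by metis+
        then show "?m + axis j 1 \<in> \<Omega>" "?m - axis j 1 \<in> \<Omega>" for j
          using nb[of j] cone by (cases "j = i"; blast)+
      qed
      have sm1: "s * ?m $ i \<ge> M - int N"
        using sm ss by (simp add: axis_component algebra_simps)
      have sm2: "s * (?m + axis i s) $ i \<ge> M - int N"
        using sm ss by (simp add: axis_component algebra_simps)
      have "u ?m = 0" "u (?m + axis i s) = 0"
        using Suc m1 m2 sm1 sm2 by auto
      have z: "u (?m + axis j 1) = 0" "u (?m - axis j 1) = 0" if "j \<noteq> i" for j
      proof -
        have "s * (?m + axis j 1) $ i \<ge> M - int N" "s * (?m - axis j 1) $ i \<ge> M - int N"
          using sm1 that by (auto simp: axis_component)
        then show "u (?m + axis j 1) = 0" "u (?m - axis j 1) = 0"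
          using Suc nb[OF that] by auto
      qed
      have "nbr_sum u ?m = u (?m + axis i 1) + u (?m - axis i 1)
          + (\<Sum>j\<in>UNIV - {i}. u (?m + axis j 1) + u (?m - axis j 1))"
        by (simp add: nbr_sum_def sum.remove[of UNIV i])
      also have "(\<Sum>j\<in>UNIV - {i}. u (?m + axis j 1) + u (?m - axis j 1)) = 0"
        using z by (intro sum.neutral) auto
      also have "u (?m + axis i 1) + u (?m - axis i 1) + 0 = u m"
        using nbi \<open>u (?m + axis i s) = 0\<close> by (metis add.right_neutral add_0)
      finally show "u m = 0"
        using eq[OF \<open>?m \<in> lattice_interior \<Omega>\<close> \<open>u ?m = 0\<close>] by simp
    qed
  qed
  moreover have "n \<in> lattice_cone i s n" by (simp add: lattice_cone_def)
  moreover have "s * n $ i \<ge> M - int (nat (M - s * n $ i))" by simp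
  ultimately show ?thesis by blast
qed

section \<open>Superpositions of plane waves\<close>

text \<open>The indicator makes this an integral over the whole line, the shape of one factor in the
  product integral over the cube.\<close>

lemma integral_cis_int:
  "(LBINT y. indicator {0..1} y *\<^sub>R cis (2 * pi * of_int m * y)) = (if m = 0 then 1 else 0)"
proof -
  have "set_integrable lborel {0..1} (\<lambda>y. cis (2 * pi * of_int m * y))"
    unfolding set_integrable_def
    by (intro borel_integrable_compact) (auto simp: cis_conv_exp intro!: continuous_intros)
  then have "(LBINT y. indicator {0..1} y *\<^sub>R cis (2 * pi * of_int m * y))
      = integral {0..1} (\<lambda>y. cis (2 * pi * of_int m * y))"
    using set_borel_integral_eq_integral(2) unfolding set_lebesgue_integral_def by blast
  also have "\<dots> = (if m = 0 then 1 else 0)"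
  proof (cases "m = 0")
    case False
    define c :: complex where "c = 2 * pi * of_int m * \<i>"
    have c: "c \<noteq> 0" using False by (simp add: c_def)
    have "((\<lambda>y. exp (c * of_real y)) has_integral exp (c * of_real 1) / c - exp (c * of_real 0) / c) {0..1}"
      using c by (intro fundamental_theorem_of_calculus)
        (auto intro!: derivative_eq_intros has_vector_derivative_real_field simp: field_simps)
    moreover have "exp (c * of_real 1) = 1"
      using cis_multiple_2pi[of "of_int m"] by (simp add: c_def cis_conv_exp mult_ac)
    moreover have "(\<lambda>y. cis (2 * pi * of_int m * y)) = (\<lambda>y. exp (c * of_real y))"
      by (auto simp: fun_eq_iff cis_conv_exp c_def mult_ac)
    ultimately show ?thesis using False by (simp add: integral_unique)
  qed simp
  finally show ?thesis .
qed

lemma cis_sum: "finite A \<Longrightarrow> cis (\<Sum>j\<in>A. f j) = (\<Prod>j\<in>A. cis (f j))"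
  by (induction A rule: finite_induct) (auto simp: cis_mult[symmetric])

text \<open>Lebesgue measure is a product over the basis vectors and the integrand factors, so
  Fubini reduces the claim to one dimension.\<close>

lemma integral_cis_cbox:
  fixes n :: "int ^ 'd"
  shows "integral (cbox 0 1) (\<lambda>x :: real ^ 'd. cis (2 * pi * (\<Sum>j\<in>UNIV. of_int (n $ j) * x $ j)))
    = (if n = 0 then 1 else 0)"
proof -
  let ?g = "\<lambda>x :: real ^ 'd. cis (2 * pi * (\<Sum>j\<in>UNIV. of_int (n $ j) * x $ j))"
  define \<phi> where "\<phi> j y = indicator {0..1} y *\<^sub>R cis (2 * pi * of_int (n $ j) * y)" for j :: 'd and y :: real
  have prod_\<phi>: "(\<Prod>j\<in>UNIV. \<phi> j (x $ j)) = indicator (cbox 0 1) x *\<^sub>R ?g x" for x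
  proof -
    have "(\<Prod>j\<in>UNIV. \<phi> j (x $ j))
        = (\<Prod>j\<in>UNIV. of_real (indicator {0..1} (x $ j))) * (\<Prod>j\<in>UNIV. cis (2 * pi * of_int (n $ j) * x $ j))"
      by (simp add: \<phi>_def scaleR_conv_of_real prod.distrib)
    also have "(\<Prod>j\<in>UNIV. cis (2 * pi * of_int (n $ j) * x $ j)) = ?g x"
      by (simp add: cis_sum[symmetric] sum_distrib_left mult_ac)
    also have "(\<Prod>j\<in>UNIV. of_real (indicator {0..1} (x $ j))) = (of_real (indicator (cbox 0 1) x) :: complex)"
      by (auto simp: indicator_def mem_box_cart)
    finally show ?thesis
      by (simp add: scaleR_conv_of_real)
  qed
  \<comment> \<open>The product measure is indexed by basis vectors and the factors
    \<open>\<phi>\<close> by coordinates; \<open>ix\<close> translates between them.\<close>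
  define ix where "ix b = (THE j. b = axis j (1::real))" for b :: "real ^ 'd"
  have ix: "ix (axis j 1) = j" for j
    by (simp add: ix_def axis_eq_axis)
  have Basis: "(Basis :: (real ^ 'd) set) = range (\<lambda>j. axis j 1)"
    by (auto simp: Basis_vec_def)
  have inj: "inj (\<lambda>j :: 'd. axis j (1::real))"
    by (auto simp: inj_def axis_eq_axis)
  have int\<phi>: "integrable lborel (\<phi> j)" for j
    unfolding \<phi>_def
    by (intro borel_integrable_compact) (auto simp: cis_conv_exp intro!: continuous_intros)
  interpret product_sigma_finite "\<lambda>_ :: real ^ 'd. lborel :: real measure"
    by standard
  have cont: "continuous_on A ?g" for A
    by (auto simp: cis_conv_exp intro!: continuous_intros)
  have meas: "(\<lambda>x. indicator (cbox 0 1) x *\<^sub>R ?g x) \<in> borel_measurable borel"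
    by (intro borel_measurable_continuous_on_indicator cont) auto
  have "set_integrable lborel (cbox 0 1) ?g"
    unfolding set_integrable_def by (intro borel_integrable_compact cont) auto
  from set_borel_integral_eq_integral(2)[OF this]
  have "integral (cbox 0 1) ?g = (LINT x|lborel. indicator (cbox 0 1) x *\<^sub>R ?g x)"
    unfolding set_lebesgue_integral_def by (rule sym)
  also have "\<dots> = (LINT f|(\<Pi>\<^sub>M b\<in>Basis. lborel).
      indicator (cbox 0 1) (\<Sum>b\<in>Basis. f b *\<^sub>R b :: real ^ 'd) *\<^sub>R ?g (\<Sum>b\<in>Basis. f b *\<^sub>R b))"
    by (subst lborel_eq, subst integral_distr) (use meas in auto)
  also have "\<dots> = (LINT f|(\<Pi>\<^sub>M b\<in>(Basis :: (real ^ 'd) set). lborel). (\<Prod>b\<in>Basis. \<phi> (ix b) (f b)))"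
  proof (intro Bochner_Integration.integral_cong refl)
    fix f :: "real ^ 'd \<Rightarrow> real"
    let ?x = "\<Sum>b\<in>Basis. f b *\<^sub>R b :: real ^ 'd"
    have x: "?x $ j = f (axis j 1)" for j
      unfolding Basis by (subst sum.reindex[OF inj]) (simp add: axis_component if_distrib cong: if_cong)
    have "(\<Prod>b\<in>Basis. \<phi> (ix b) (f b)) = (\<Prod>j\<in>UNIV. \<phi> j (f (axis j 1)))"
      unfolding Basis by (subst prod.reindex[OF inj]) (simp add: ix)
    also have "\<dots> = (\<Prod>j\<in>UNIV. \<phi> j (?x $ j))"
      by (simp only: x)
    also have "\<dots> = indicator (cbox 0 1) ?x *\<^sub>R ?g ?x"
      by (rule prod_\<phi>)
    finally show "indicator (cbox 0 1) ?x *\<^sub>R ?g ?x = (\<Prod>b\<in>Basis. \<phi> (ix b) (f b))"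
      by (rule sym)
  qed
  also have "\<dots> = (\<Prod>b\<in>(Basis :: (real ^ 'd) set). integral\<^sup>L lborel (\<phi> (ix b)))"
    by (intro product_integral_prod int\<phi>) auto
  also have "\<dots> = (\<Prod>j\<in>UNIV. integral\<^sup>L lborel (\<phi> j))"
    unfolding Basis by (subst prod.reindex[OF inj]) (simp add: ix)
  also have "\<dots> = (\<Prod>j\<in>UNIV. if n $ j = 0 then 1 else 0)"
    unfolding \<phi>_def integral_cis_int by simp
  also have "\<dots> = (if n = 0 then 1 else 0)"
    by (auto simp: vec_eq_iff)
  finally show ?thesis .
qed

text \<open>The coordinate \<open>x $ i\<close> is a dummy; it is kept so that the unit cube of \<open>real ^ 'd\<close> can serve as
  the torus dual to the hyperplanes \<open>n $ i = const\<close>.\<close>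

definition plane_wave :: "'d \<Rightarrow> int ^ 'd \<Rightarrow> real ^ 'd \<Rightarrow> complex" where
  "plane_wave i n x = cis (2 * pi * (\<Sum>j\<in>UNIV - {i}. of_int (n $ j) * x $ j))"

lemma continuous_on_plane_wave [continuous_intros]: "continuous_on A (plane_wave i n)"
  unfolding plane_wave_def by (auto simp: cis_conv_exp intro!: continuous_intros)

lemma norm_plane_wave [simp]: "cmod (plane_wave i n x) = 1"
  by (simp add: plane_wave_def)

lemma plane_wave_mult_cnj: "plane_wave i n x * cnj (plane_wave i m x) = plane_wave i (n - m) x"
  by (simp add: plane_wave_def cis_cnj cis_mult left_diff_distrib sum_subtractf right_diff_distrib)

lemma integral_plane_wave: "integral (cbox 0 1) (plane_wave i n) = (if \<forall>j. j \<noteq> i \<longrightarrow> n $ j = 0 then 1 else 0)"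
proof -
  define n' where "n' = (\<chi> j. if j = i then 0 else n $ j)"
  have "plane_wave i n = (\<lambda>x. cis (2 * pi * (\<Sum>j\<in>UNIV. of_int (n' $ j) * x $ j)))"
    by (auto simp: fun_eq_iff plane_wave_def n'_def sum.remove[of UNIV i] intro!: sum.cong)
  moreover have "n' = 0 \<longleftrightarrow> (\<forall>j. j \<noteq> i \<longrightarrow> n $ j = 0)"
    by (auto simp: n'_def vec_eq_iff)
  ultimately show ?thesis
    by (simp only: integral_cis_cbox)
qed

lemma plane_wave_add_axis:
  "plane_wave i (n + axis j 1) x = (if j = i then plane_wave i n x else plane_wave i n x * cis (2 * pi * x $ j))"
  "plane_wave i (n - axis j 1) x = (if j = i then plane_wave i n x else plane_wave i n x * cnj (cis (2 * pi * x $ j)))"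
proof -
  have a: "(\<Sum>k\<in>UNIV - {i}. of_int (axis j 1 $ k) * x $ k) = (if j = i then 0 else x $ j)"
  proof -
    have "(\<Sum>k\<in>UNIV - {i}. of_int (axis j 1 $ k) * x $ k) = (\<Sum>k\<in>UNIV - {i}. if k = j then x $ j else 0)"
      by (intro sum.cong) (auto simp: axis_component)
    then show ?thesis by simp
  qed
  show "plane_wave i (n + axis j 1) x = (if j = i then plane_wave i n x else plane_wave i n x * cis (2 * pi * x $ j))"
    by (simp add: plane_wave_def distrib_right sum.distrib a distrib_left cis_mult)
  show "plane_wave i (n - axis j 1) x = (if j = i then plane_wave i n x else plane_wave i n x * cnj (cis (2 * pi * x $ j)))"
    by (simp add: plane_wave_def left_diff_distrib sum_subtractf a right_diff_distrib cis_mult cis_cnj)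
qed

text \<open>This is the parameter t of the fibre recurrence: a pair of neighbours in a direction
  other than \<open>i\<close> contributes the multiplier
  \<open>2 * cos (2 * pi * x $ j)\<close>.\<close>

definition fibre_symbol :: "real \<Rightarrow> 'd \<Rightarrow> real ^ 'd \<Rightarrow> real" where
  "fibre_symbol E i x = E - (\<Sum>j\<in>UNIV - {i}. 2 * cos (2 * pi * x $ j))"

lemma continuous_on_fibre_symbol [continuous_intros]: "continuous_on A (fibre_symbol E i)"
  unfolding fibre_symbol_def by (intro continuous_intros)

text \<open>Fourier synthesis in all variables but the \<open>i\<close>-th, with the multiplier
  \<open>a k\<close> on the layer \<open>n $ i = k\<close>.\<close>

definition wave :: "'d \<Rightarrow> (int \<Rightarrow> real ^ 'd \<Rightarrow> complex) \<Rightarrow> int ^ 'd \<Rightarrow> complex" where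
  "wave i a n = integral (cbox 0 1) (\<lambda>x. a (n $ i) x * plane_wave i n x)"

lemma has_integral_wave:
  fixes a :: "int \<Rightarrow> real ^ 'd \<Rightarrow> complex"
  assumes "\<And>k. continuous_on UNIV (a k)"
  shows "((\<lambda>x. a (n $ i) x * plane_wave i n x) has_integral wave i a n) (cbox 0 1)"
  unfolding wave_def
  by (intro integrable_integral integrable_continuous continuous_intros)
     (use assms continuous_on_subset in blast)

text \<open>Shifts in the direction \<open>i\<close> change the index of \<open>a\<close>; the other
  shifts multiply the plane wave by conjugate phases, which add up to a real cosine.\<close>

lemma helmholtz_wave:
  fixes a :: "int \<Rightarrow> real ^ 'd \<Rightarrow> complex"
  assumes "\<And>k. continuous_on UNIV (a k)"
  shows "helmholtz E (wave i a) n = integral (cbox 0 1)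
    (\<lambda>x. (a (n $ i + 1) x + a (n $ i - 1) x - of_real (fibre_symbol E i x) * a (n $ i) x) * plane_wave i n x)"
proof -
  let ?I = "\<lambda>m x. a (m $ i) x * plane_wave i m x"
  have "((\<lambda>x. ?I (n + axis i 1) x + ?I (n - axis i 1) x
      + (\<Sum>j\<in>UNIV - {i}. ?I (n + axis j 1) x + ?I (n - axis j 1) x) - of_real E * ?I n x)
      has_integral helmholtz E (wave i a) n) (cbox 0 1)"
    unfolding helmholtz_split[of _ _ _ i]
    by (intro has_integral_diff has_integral_add has_integral_sum has_integral_mult_right
        has_integral_wave assms) auto
  moreover have "?I (n + axis i 1) x + ?I (n - axis i 1) x
      + (\<Sum>j\<in>UNIV - {i}. ?I (n + axis j 1) x + ?I (n - axis j 1) x) - of_real E * ?I n x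
    = (a (n $ i + 1) x + a (n $ i - 1) x - of_real (fibre_symbol E i x) * a (n $ i) x) * plane_wave i n x" for x
  proof -
    have "(\<Sum>j\<in>UNIV - {i}. ?I (n + axis j 1) x + ?I (n - axis j 1) x)
        = (\<Sum>j\<in>UNIV - {i}. of_real (2 * cos (2 * pi * x $ j)) * ?I n x)"
    proof (intro sum.cong refl)
      fix j assume "j \<in> UNIV - {i}"
      then have "?I (n + axis j 1) x + ?I (n - axis j 1) x
          = ?I n x * (cis (2 * pi * x $ j) + cnj (cis (2 * pi * x $ j)))"
        by (simp add: axis_component plane_wave_add_axis algebra_simps)
      also have "cis (2 * pi * x $ j) + cnj (cis (2 * pi * x $ j)) = of_real (2 * cos (2 * pi * x $ j))"
        by (simp add: complex_eq_iff)
      finally show "?I (n + axis j 1) x + ?I (n - axis j 1) x = of_real (2 * cos (2 * pi * x $ j)) * ?I n x"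
        by (simp add: mult_ac)
    qed
    also have "\<dots> = of_real (\<Sum>j\<in>UNIV - {i}. 2 * cos (2 * pi * x $ j)) * ?I n x"
      by (simp only: sum_distrib_right of_real_sum)
    also have "(\<Sum>j\<in>UNIV - {i}. 2 * cos (2 * pi * x $ j)) = E - fibre_symbol E i x"
      by (simp add: fibre_symbol_def)
    finally have sum_eq: "(\<Sum>j\<in>UNIV - {i}. ?I (n + axis j 1) x + ?I (n - axis j 1) x)
        = of_real (E - fibre_symbol E i x) * ?I n x" .
    show ?thesis
      unfolding sum_eq by (simp add: plane_wave_add_axis axis_component algebra_simps)
  qed
  ultimately show ?thesis by (simp add: integral_unique)
qed

text \<open>This is Bessel's inequality: the plane waves belonging to distinct points of one layer
  are orthonormal on the cube.\<close>

lemma wave_bessel: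
  fixes a :: "int \<Rightarrow> real ^ 'd \<Rightarrow> complex"
  assumes cont: "\<And>k. continuous_on UNIV (a k)" and bd: "\<And>k x. cmod (a k x) \<le> C"
    and S: "finite S" "\<And>n. n \<in> S \<Longrightarrow> n $ i = k"
  shows "(\<Sum>n\<in>S. (cmod (wave i a n))\<^sup>2) \<le> C\<^sup>2"
proof -
  define v where "v = wave i a"
  define s where "s = (\<Sum>n\<in>S. (cmod (v n))\<^sup>2)"
  \<comment> \<open>Pairing \<open>a k\<close> with this trigonometric polynomial gives
    \<open>s\<close>, and its own squared norm is \<open>s\<close> as well.\<close>
  define W where "W x = (\<Sum>n\<in>S. cnj (v n) * plane_wave i n x)" for x
  have contW: "continuous_on A W" for A
    unfolding W_def by (intro continuous_intros)
  have conta: "continuous_on A (a k)" for A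
    using cont continuous_on_subset by blast
  have C: "C \<ge> 0" using bd[of 0 0] norm_ge_zero order_trans by blast
  have "((\<lambda>x. \<Sum>n\<in>S. cnj (v n) * (a (n $ i) x * plane_wave i n x)) has_integral (\<Sum>n\<in>S. cnj (v n) * v n)) (cbox 0 1)"
    unfolding v_def by (intro has_integral_sum has_integral_mult_right has_integral_wave cont S)
  moreover have "(\<Sum>n\<in>S. cnj (v n) * (a (n $ i) x * plane_wave i n x)) = a k x * W x" for x
    unfolding W_def sum_distrib_left using S(2) by (intro sum.cong) (auto simp: mult_ac)
  moreover have "(\<Sum>n\<in>S. cnj (v n) * v n) = of_real s"
    unfolding s_def of_real_sum
    by (intro sum.cong refl) (metis complex_norm_square mult.commute)
  ultimately have aW: "((\<lambda>x. a k x * W x) has_integral of_real s) (cbox 0 1)"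
    by simp
  have pwint: "(plane_wave i n has_integral (if \<forall>j. j \<noteq> i \<longrightarrow> n $ j = 0 then 1 else 0)) (cbox 0 1)" for n
    unfolding integral_plane_wave[symmetric] by (intro integrable_integral integrable_continuous continuous_intros)
  have "((\<lambda>x. \<Sum>n\<in>S. \<Sum>m\<in>S. (cnj (v n) * v m) * plane_wave i (n - m) x) has_integral
      (\<Sum>n\<in>S. \<Sum>m\<in>S. (cnj (v n) * v m) * (if \<forall>j. j \<noteq> i \<longrightarrow> (n - m) $ j = 0 then 1 else 0))) (cbox 0 1)"
    by (intro has_integral_sum S has_integral_mult_right pwint)
  moreover have "(\<Sum>n\<in>S. \<Sum>m\<in>S. (cnj (v n) * v m) * plane_wave i (n - m) x) = of_real ((cmod (W x))\<^sup>2)" for x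
    unfolding complex_norm_square W_def
    by (simp add: sum_product plane_wave_mult_cnj[symmetric] mult_ac) (rule sum.swap)
  moreover have "(\<Sum>n\<in>S. \<Sum>m\<in>S. (cnj (v n) * v m) * (if \<forall>j. j \<noteq> i \<longrightarrow> (n - m) $ j = 0 then 1 else 0))
     = of_real s"
  proof -
    have iff: "(\<forall>j. j \<noteq> i \<longrightarrow> (n - m) $ j = 0) \<longleftrightarrow> m = n" if "n \<in> S" "m \<in> S" for n m
      using S(2)[OF that(1)] S(2)[OF that(2)] by (auto simp: vec_eq_iff)
    have "(\<Sum>m\<in>S. (cnj (v n) * v m) * (if \<forall>j. j \<noteq> i \<longrightarrow> (n - m) $ j = 0 then 1 else 0))
        = of_real ((cmod (v n))\<^sup>2)" if "n \<in> S" for n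
    proof -
      have "(\<Sum>m\<in>S. (cnj (v n) * v m) * (if \<forall>j. j \<noteq> i \<longrightarrow> (n - m) $ j = 0 then 1 else 0))
          = (\<Sum>m\<in>S. if m = n then cnj (v n) * v n else 0)"
        using iff[OF that] by (intro sum.cong refl) auto
      also have "\<dots> = cnj (v n) * v n"
        using S(1) that by simp
      also have "\<dots> = of_real ((cmod (v n))\<^sup>2)"
        by (metis complex_norm_square mult.commute)
      finally show ?thesis .
    qed
    then show ?thesis by (simp add: s_def)
  qed
  ultimately have "((\<lambda>x. of_real ((cmod (W x))\<^sup>2) :: complex) has_integral of_real s) (cbox 0 1)"
    by simp
  from has_integral_linear[OF this bounded_linear_Re]
  have WW: "((\<lambda>x. (cmod (W x))\<^sup>2) has_integral s) (cbox 0 1)"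
    by (simp add: o_def)
  have one: "((\<lambda>x :: real ^ 'd. C\<^sup>2) has_integral C\<^sup>2) (cbox 0 1)"
  proof -
    have "measure lborel (cbox 0 (1 :: real ^ 'd)) = 1"
      by (subst content_cbox_cart) (auto simp: interval_ne_empty_cart)
    then show ?thesis
      using has_integral_const[of "C\<^sup>2" "0 :: real ^ 'd" 1] by simp
  qed
  have G: "((\<lambda>x. (C\<^sup>2 + (cmod (W x))\<^sup>2) / 2) has_integral (C\<^sup>2 + s) / 2) (cbox 0 1)"
    by (intro has_integral_divide has_integral_add one WW)
  \<comment> \<open>The arithmetic-geometric mean inequality in the integrand gives s \<le> (C^2 +
    s) / 2, which absorbs \<open>s\<close> on the right.\<close>
  have "cmod (of_real s) \<le> (C\<^sup>2 + s) / 2"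
  proof -
    have "cmod (a k x * W x) \<le> (C\<^sup>2 + (cmod (W x))\<^sup>2) / 2" for x
    proof -
      have "cmod (a k x * W x) \<le> C * cmod (W x)"
        unfolding norm_mult by (intro mult_right_mono bd) auto
      also have "\<dots> \<le> (C\<^sup>2 + (cmod (W x))\<^sup>2) / 2"
        using sum_squares_bound[of C "cmod (W x)"] by simp
      finally show ?thesis .
    qed
    then have "norm (integral (cbox 0 1) (\<lambda>x. a k x * W x))
        \<le> integral (cbox 0 1) (\<lambda>x. (C\<^sup>2 + (cmod (W x))\<^sup>2) / 2)"
      using aW G by (intro integral_norm_bound_integral) auto
    then show ?thesis unfolding integral_unique[OF aW] integral_unique[OF G] .
  qed
  then have "s \<le> C\<^sup>2" by simp
  then show ?thesis by (simp add: s_def v_def)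
qed

text \<open>A ball of radius r meets at most 2 r + 1 \<le> 3 r layers, and Bessel's inequality
  bounds the mass on each by \<open>C\<^sup>2\<close>.\<close>

lemma linear_growth_wave:
  fixes a :: "int \<Rightarrow> real ^ 'd \<Rightarrow> complex"
  assumes cont: "\<And>k. continuous_on UNIV (a k)" and bd: "\<And>k x. cmod (a k x) \<le> C"
  shows "linear_growth (wave i a)"
  unfolding linear_growth_def
proof (intro exI conjI allI impI)
  show "0 \<le> 3 * C\<^sup>2" by simp
  fix r :: real assume r: "1 \<le> r"
  let ?T = "{- \<lfloor>r\<rfloor>..\<lfloor>r\<rfloor>}"
  have sub: "(\<lambda>n. n $ i) ` lattice_ball r \<subseteq> ?T"
  proof
    fix k assume "k \<in> (\<lambda>n. n $ i) ` lattice_ball r"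
    then obtain n where "k = n $ i" "lattice_norm n \<le> r"
      by (auto simp: lattice_ball_def)
    then have "\<bar>real_of_int k\<bar> \<le> r"
      using component_le_lattice_norm[of n i] by simp
    then have "k \<le> \<lfloor>r\<rfloor>" "- k \<le> \<lfloor>r\<rfloor>"
      unfolding le_floor_iff by simp_all
    then show "k \<in> ?T" by simp
  qed
  have "(\<Sum>n\<in>lattice_ball r. (cmod (wave i a n))\<^sup>2)
     = (\<Sum>k\<in>?T. \<Sum>n | n \<in> lattice_ball r \<and> n $ i = k. (cmod (wave i a n))\<^sup>2)"
    by (rule sum.group[symmetric]) (use sub in auto)
  also have "\<dots> \<le> (\<Sum>k\<in>?T. C\<^sup>2)"
    by (intro sum_mono wave_bessel cont bd) auto
  also have "\<dots> = real_of_int (2 * \<lfloor>r\<rfloor> + 1) * C\<^sup>2"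
    using r by (simp add: le_floor_iff)
  also have "\<dots> \<le> (3 * r) * C\<^sup>2"
  proof (rule mult_right_mono)
    show "real_of_int (2 * \<lfloor>r\<rfloor> + 1) \<le> 3 * r"
      using r of_int_floor_le[of r] by linarith
  qed simp
  finally show "(\<Sum>n\<in>lattice_ball r. (cmod (wave i a n))\<^sup>2) \<le> 3 * C\<^sup>2 * r"
    by (simp add: mult_ac)
qed

section \<open>Bounded solutions of the fibre recurrence\<close>

text \<open>The angle \<theta> with t = 2 cos \<theta>, extended continuously to the whole line by
  clamping.\<close>

definition angle :: "real \<Rightarrow> real" where
  "angle t = arccos (max (- 1) (min 1 (t / 2)))"

lemma cos_angle: "cos (angle t) = max (- 1) (min 1 (t / 2))"
  by (simp add: angle_def cos_arccos_abs)

lemma continuous_on_angle [continuous_intros]: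
  "continuous_on A f \<Longrightarrow> continuous_on A (\<lambda>x. angle (f x))"
  unfolding angle_def by (intro continuous_intros) auto

lemma sin_angle_eq_0:
  assumes "\<bar>t\<bar> \<ge> 2"
  shows "sin (angle t) = 0"
proof -
  have "max (- 1) (min 1 (t / 2)) = 1 \<or> max (- 1) (min 1 (t / 2)) = - 1"
    using assms by linarith
  then show ?thesis by (auto simp: angle_def)
qed

lemma sin_angle_neq_0: "\<bar>t\<bar> < 2 \<Longrightarrow> sin (angle t) \<noteq> 0"
proof -
  assume t: "\<bar>t\<bar> < 2"
  then have "max (- 1) (min 1 (t / 2)) = t / 2" by (auto simp: max_def min_def)
  then have "cos (angle t) = t / 2" by (simp add: cos_angle)
  moreover have "\<bar>t / 2\<bar> < 1" using t by simp
  then have "(t / 2)\<^sup>2 < 1" by (simp add: abs_square_less_1)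
  ultimately have "(cos (angle t))\<^sup>2 < 1" by (simp only:)
  then show ?thesis
    using sin_cos_squared_add[of "angle t"] by (intro notI) simp
qed

text \<open>The factor \<open>sin (angle t)\<close> vanishes for \<open>\<bar>t\<bar> \<ge> 2\<close>, where the clamping in \<open>angle\<close> breaks
  \<open>t = 2 * cos (angle t)\<close>; so the recurrence \<open>sine_sol_rec\<close> holds for every \<open>t\<close>.\<close>

definition sine_sol :: "int \<Rightarrow> real \<Rightarrow> real" where
  "sine_sol k t = sin (of_int k * angle t) * sin (angle t)"

lemma sine_sol_rec: "sine_sol (k + 1) t + sine_sol (k - 1) t = t * sine_sol k t"
proof (cases "\<bar>t\<bar> < 2")
  case True
  then have "max (- 1) (min 1 (t / 2)) = t / 2" by (auto simp: max_def min_def)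
  then have "t = 2 * cos (angle t)" by (simp add: cos_angle)
  moreover have "sine_sol (k + 1) t + sine_sol (k - 1) t = 2 * cos (angle t) * sine_sol k t"
    by (simp add: sine_sol_def algebra_simps sin_add sin_diff)
  ultimately show ?thesis by simp
next
  case False
  then show ?thesis by (simp add: sine_sol_def sin_angle_eq_0)
qed

lemma abs_sine_sol_le: "\<bar>sine_sol k t\<bar> \<le> 1"
  unfolding sine_sol_def abs_mult by (intro mult_le_one) auto

text \<open>The root \<open>z\<close> of \<open>z + 1 / z = t\<close> with \<open>\<bar>z\<bar> \<le> 1\<close>, chosen continuously across \<open>\<bar>t\<bar> = 2\<close>.\<close>

definition decay :: "real \<Rightarrow> complex" where
  "decay t = of_real (max 1 (\<bar>t\<bar> / 2) - sqrt ((max 1 (\<bar>t\<bar> / 2))\<^sup>2 - 1)) * cis (angle t)"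

lemma continuous_on_decay [continuous_intros]:
  "continuous_on A f \<Longrightarrow> continuous_on A (\<lambda>x. decay (f x))"
  unfolding decay_def cis_conv_exp by (intro continuous_intros) auto

text \<open>The radial factor is in [0, 1], because \<open>sqrt (m\<^sup>2 - 1)\<close> lies between
  \<open>m - 1\<close> and \<open>m\<close> for \<open>m \<ge> 1\<close>.\<close>

lemma norm_decay_le: "cmod (decay t) \<le> 1"
proof -
  define m where "m = max 1 (\<bar>t\<bar> / 2)"
  have m: "m \<ge> 1" by (simp add: m_def)
  have "sqrt (m\<^sup>2 - 1) \<le> m"
    using m by (intro real_le_lsqrt) auto
  moreover have "m - 1 \<le> sqrt (m\<^sup>2 - 1)"
    using m by (intro real_le_rsqrt) (simp add: power2_eq_square algebra_simps)
  ultimately show ?thesis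
    unfolding decay_def norm_mult norm_of_real norm_cis m_def[symmetric] by simp
qed

text \<open>For \<open>\<bar>t\<bar> \<le> 2\<close> the root lies on the unit circle and t is twice
  its real part. Beyond that it is real: the smaller root for |t|, with the sign of t supplied by
  the clamped angle 0 or pi.\<close>

lemma decay_quadratic: "(decay t)\<^sup>2 - of_real t * decay t + 1 = 0"
proof (cases "\<bar>t\<bar> \<le> 2")
  case True
  then have "max 1 (\<bar>t\<bar> / 2) = 1" by simp
  then have d: "decay t = cis (angle t)" by (simp add: decay_def)
  have "max (- 1) (min 1 (t / 2)) = t / 2" using True by (auto simp: max_def min_def abs_if split: if_splits)
  then have t: "t = 2 * cos (angle t)" by (simp add: cos_angle)
  have "of_real t = cis (angle t) + cnj (cis (angle t))"
    by (subst t) (simp add: complex_eq_iff)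
  then show ?thesis
    by (simp add: d power2_eq_square algebra_simps cis_cnj cis_mult)
next
  case False
  define m where "m = \<bar>t\<bar> / 2"
  have m: "m > 1" using False by (simp add: m_def)
  then have max: "max 1 (\<bar>t\<bar> / 2) = m" by (simp add: m_def)
  define \<rho> where "\<rho> = m - sqrt (m\<^sup>2 - 1)"
  have "(sqrt (m\<^sup>2 - 1))\<^sup>2 = m\<^sup>2 - 1"
    using m by (intro real_sqrt_pow2) (simp add: one_le_power less_imp_le)
  then have \<rho>: "\<rho>\<^sup>2 - 2 * m * \<rho> + 1 = 0"
    by (simp add: \<rho>_def power2_eq_square algebra_simps)
  define \<sigma> :: real where "\<sigma> = sgn t"
  have t: "t = \<sigma> * (2 * m)" by (simp add: \<sigma>_def m_def sgn_mult_abs)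
  have ss: "\<sigma> * \<sigma> = 1" using False by (auto simp: \<sigma>_def sgn_if)
  have "angle t = (if t > 0 then 0 else pi)"
    using False by (auto simp: angle_def max_def min_def abs_if split: if_splits)
  then have "cis (angle t) = of_real \<sigma>"
    using False by (auto simp: \<sigma>_def sgn_if)
  then have d: "decay t = of_real (\<sigma> * \<rho>)"
    unfolding decay_def max by (simp add: \<rho>_def)
  have "(\<sigma> * \<rho>)\<^sup>2 - t * (\<sigma> * \<rho>) + 1 = (\<sigma> * \<sigma>) * (\<rho>\<^sup>2 - 2 * m * \<rho>) + 1"
    by (subst t) (simp add: power2_eq_square algebra_simps)
  also have "\<dots> = 0" using ss \<rho> by simp
  finally have "complex_of_real ((\<sigma> * \<rho>)\<^sup>2 - t * (\<sigma> * \<rho>) + 1) = 0" by (simp only: of_real_0)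
  then show ?thesis unfolding d by simp
qed

text \<open>With \<open>z = decay t\<close> this is the central difference of the Green kernel
  \<open>z ^ \<bar>k\<bar> / (z - 1 / z)\<close>; the difference cancels the denominator, which vanishes at the thresholds
  \<open>\<bar>t\<bar> = 2\<close>.\<close>

definition odd_sol :: "int \<Rightarrow> real \<Rightarrow> complex" where
  "odd_sol k t = (if k > 0 then decay t ^ nat k else if k < 0 then - (decay t ^ nat (- k)) else 0)"

lemma odd_sol_minus: "odd_sol (- k) t = - odd_sol k t"
  by (auto simp: odd_sol_def)

text \<open>Powers of a root of the quadratic solve the recurrence. At \<open>k = 1\<close> the
  value at 0 is 0 rather than \<open>decay t ^ 0 = 1\<close>, which leaves a source of strength
  -1.\<close>

lemma odd_sol_rec_pos:
  assumes "k > 0"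
  shows "odd_sol (k + 1) t + odd_sol (k - 1) t - of_real t * odd_sol k t = (if k = 1 then - 1 else 0)"
proof (cases "k = 1")
  case True
  then show ?thesis
    using decay_quadratic[of t] by (simp add: odd_sol_def algebra_simps power2_eq_square eq_neg_iff_add_eq_0)
next
  case False
  define j where "j = nat (k - 2)"
  have k: "k = int j + 2" using assms False by (simp add: j_def)
  have e: "odd_sol (k + 1) t = decay t ^ j * (decay t)^3" "odd_sol (k - 1) t = decay t ^ j * decay t"
    "odd_sol k t = decay t ^ j * (decay t)\<^sup>2"
    by (simp_all add: odd_sol_def k nat_add_distrib power_add numeral_eq_Suc mult_ac)
  have "odd_sol (k + 1) t + odd_sol (k - 1) t - of_real t * odd_sol k t
      = decay t ^ j * decay t * ((decay t)\<^sup>2 - of_real t * decay t + 1)"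
    unfolding e by (simp add: power2_eq_square power3_eq_cube algebra_simps)
  then show ?thesis using False decay_quadratic[of t] by simp
qed

lemma odd_sol_rec:
  "odd_sol (k + 1) t + odd_sol (k - 1) t - of_real t * odd_sol k t
     = (if k = 1 then - 1 else if k = - 1 then 1 else 0)"
proof -
  consider "k > 0" | "k = 0" | "k < 0" by linarith
  then show ?thesis
  proof cases
    case 1
    then show ?thesis using odd_sol_rec_pos[of k t] by simp
  next
    case 2
    then show ?thesis by (simp add: odd_sol_def)
  next
    case 3
    have "odd_sol (- k + 1) t + odd_sol (- k - 1) t - of_real t * odd_sol (- k) t = (if - k = 1 then - 1 else 0)"
      using 3 by (intro odd_sol_rec_pos) simp
    moreover have "odd_sol (- k + 1) t = - odd_sol (k - 1) t" "odd_sol (- k - 1) t = - odd_sol (k + 1) t"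
      using odd_sol_minus[of "k - 1" t] odd_sol_minus[of "k + 1" t] by simp_all
    ultimately show ?thesis using 3 by (auto simp: odd_sol_minus algebra_simps split: if_splits)
  qed
qed

lemma norm_odd_sol_le: "cmod (odd_sol k t) \<le> 1"
  by (auto simp: odd_sol_def norm_power norm_decay_le intro!: power_le_one)

lemma continuous_on_odd_sol [continuous_intros]:
  "continuous_on A f \<Longrightarrow> continuous_on A (\<lambda>x. odd_sol k (f x))"
  unfolding odd_sol_def by (cases "k > 0"; cases "k < 0"; simp; intro continuous_intros; assumption)

text \<open>Green's identity is tested against a wave whose sources are two points of opposite sign
  at \<open>m \<plusminus> axis i 1\<close>. It equates the values of \<open>u\<close> there, and
  periodicity contradicts the growth bound unless \<open>u\<close> vanishes.\<close>

lemma eq_0_of_helmholtz_eq_0: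
  fixes u :: "int ^ 'd \<Rightarrow> complex"
  assumes u: "sublinear_growth u" and hel: "\<And>n. helmholtz E u n = 0"
  shows "u n = 0"
proof -
  obtain i :: 'd where True by simp
  have "u (m + axis i 1) = u (m - axis i 1)" for m
  proof -
    \<comment> \<open>The shift of the index and the conjugate plane wave centre the kernel at
      \<open>m\<close>.\<close>
    define a where "a k x = odd_sol (k - m $ i) (fibre_symbol E i x) * cnj (plane_wave i m x)" for k x
    have cont: "continuous_on UNIV (a k)" for k
      unfolding a_def by (intro continuous_intros)
    have bd: "cmod (a k x) \<le> 1" for k x
      by (simp add: a_def norm_mult norm_odd_sol_le)
    let ?F = "{m + axis i 1, m - axis i 1}"
    have ne: "m + axis i 1 \<noteq> m - axis i 1"
      by (auto simp: vec_eq_iff axis_component intro!: exI[of _ i])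
    have hw: "helmholtz E (wave i a) n
        = (if n = m + axis i 1 then - 1 else if n = m - axis i 1 then 1 else 0)" for n
    proof -
      define c :: complex where "c = (if n $ i - m $ i = 1 then - 1 else if n $ i - m $ i = - 1 then 1 else 0)"
      have "(a (n $ i + 1) x + a (n $ i - 1) x - of_real (fibre_symbol E i x) * a (n $ i) x) * plane_wave i n x
          = c * plane_wave i (n - m) x" for x
      proof -
        have "a (n $ i + 1) x + a (n $ i - 1) x - of_real (fibre_symbol E i x) * a (n $ i) x
            = (odd_sol (n $ i - m $ i + 1) (fibre_symbol E i x) + odd_sol (n $ i - m $ i - 1) (fibre_symbol E i x)
                - of_real (fibre_symbol E i x) * odd_sol (n $ i - m $ i) (fibre_symbol E i x)) * cnj (plane_wave i m x)"
          by (simp add: a_def algebra_simps)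
        also have "\<dots> = c * cnj (plane_wave i m x)"
          unfolding odd_sol_rec c_def ..
        finally have "a (n $ i + 1) x + a (n $ i - 1) x - of_real (fibre_symbol E i x) * a (n $ i) x
            = c * cnj (plane_wave i m x)" .
        then show ?thesis by (simp add: plane_wave_mult_cnj[symmetric])
      qed
      then have "helmholtz E (wave i a) n = c * integral (cbox 0 1) (plane_wave i (n - m))"
        by (simp add: helmholtz_wave[OF cont])
      also have "\<dots> = (if n = m + axis i 1 then - 1 else if n = m - axis i 1 then 1 else 0)"
      proof -
        have p: "n = m + axis i 1 \<longleftrightarrow> n $ i - m $ i = 1 \<and> (\<forall>j. j \<noteq> i \<longrightarrow> (n - m) $ j = 0)"
          by (auto simp: vec_eq_iff axis_component)
        have q: "n = m - axis i 1 \<longleftrightarrow> n $ i - m $ i = - 1 \<and> (\<forall>j. j \<noteq> i \<longrightarrow> (n - m) $ j = 0)"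
          by (auto simp: vec_eq_iff axis_component)
        show ?thesis unfolding p q integral_plane_wave c_def by auto
      qed
      finally show ?thesis .
    qed
    have "(\<Sum>n\<in>?F. helmholtz E u n * wave i a n) = (\<Sum>n\<in>?F. u n * helmholtz E (wave i a) n)"
      by (intro green_identity u linear_growth_wave[OF cont bd]) (auto simp: hel hw)
    then show ?thesis using ne by (simp add: hel hw)
  qed
  then show ?thesis using periodic_sublinear_growth_eq_0[OF u] by blast
qed

section \<open>The Rellich theorem and unique continuation\<close>

text \<open>Multiplication by a power of z clears the negative exponents and leaves a polynomial
  with infinitely many roots.\<close>

lemma laurent_eq_0:
  fixes g :: "int \<Rightarrow> complex"
  assumes T: "finite T" and Z: "infinite Z" "0 \<notin> Z"
    and eq: "\<And>z. z \<in> Z \<Longrightarrow> (\<Sum>k\<in>T. z powi k * g k) = 0" and k: "k \<in> T"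
  shows "g k = 0"
proof -
  define M where "M = (\<Sum>k\<in>T. \<bar>k\<bar>)"
  have M: "0 \<le> k + M" if "k \<in> T" for k
    using member_le_sum[of k T abs] T that by (auto simp: M_def)
  define P where "P = (\<Sum>k\<in>T. monom (g k) (nat (k + M)))"
  have "poly P z = 0" if "z \<in> Z" for z
  proof -
    have z: "z \<noteq> 0" using that Z by auto
    have "poly P z = (\<Sum>k\<in>T. z powi M * (z powi k * g k))"
      unfolding P_def poly_sum poly_monom
    proof (intro sum.cong refl)
      fix k assume "k \<in> T"
      have "z ^ nat (k + M) = z powi (k + M)"
        using M[OF \<open>k \<in> T\<close>] by (simp add: power_int_def)
      then show "g k * z ^ nat (k + M) = z powi M * (z powi k * g k)"
        using z by (simp add: power_int_add mult_ac)
    qed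
    then show ?thesis using eq[OF that] by (simp flip: sum_distrib_left)
  qed
  then have "Z \<subseteq> {z. poly P z = 0}" by auto
  then have "P = 0" using poly_roots_finite Z finite_subset by blast
  then have "coeff P (nat (k + M)) = 0" by simp
  moreover have "coeff P (nat (k + M)) = (\<Sum>k'\<in>T. if k' = k then g k else 0)"
    unfolding P_def coeff_sum
    using M k by (intro sum.cong refl) (auto simp: eq_nat_nat_iff)
  ultimately show ?thesis using k T by simp
qed

text \<open>Induction on the variables: one exponent is fixed at a time, and the hypothesis that the
  coordinates in \<open>J\<close> separate \<open>S\<close> passes to the slices.\<close>

lemma multi_laurent_eq_0:
  fixes f :: "int ^ 'd \<Rightarrow> complex"
  assumes "finite J" "finite S" and Z: "infinite Z" "0 \<notin> Z"
    and "\<And>n m. n \<in> S \<Longrightarrow> m \<in> S \<Longrightarrow> (\<forall>j\<in>J. n $ j = m $ j) \<Longrightarrow> n = m"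
    and "\<And>z. (\<And>j. z j \<in> Z) \<Longrightarrow> (\<Sum>n\<in>S. f n * (\<Prod>j\<in>J. z j powi (n $ j))) = 0"
    and "n \<in> S"
  shows "f n = 0"
  using assms(1,2,5-)
proof (induction J arbitrary: S n rule: finite_induct)
  case empty
  then have "S = {n}" by auto
  moreover obtain z where "z \<in> Z" using Z by fastforce
  ultimately show ?case using empty.prems(3)[of "\<lambda>_. z"] by simp
next
  case (insert j J)
  let ?S = "{m \<in> S. m $ j = n $ j}"
  have "(\<Sum>m\<in>?S. f m * (\<Prod>i\<in>J. z i powi (m $ i))) = 0" if z: "\<And>i. z i \<in> Z" for z
  \<comment> \<open>With the variables in \<open>J\<close> frozen, the sum is a Laurent polynomial
    in the \<open>j\<close>-th one whose coefficients are sums over slices of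
    \<open>S\<close>.\<close>
  proof (rule laurent_eq_0[where k = "n $ j" and T = "(\<lambda>m. m $ j) ` S" and Z = Z
        and g = "\<lambda>k. \<Sum>m\<in>{m \<in> S. m $ j = k}. f m * (\<Prod>i\<in>J. z i powi (m $ i))"])
    fix y assume y: "y \<in> Z"
    have "(\<Sum>k\<in>(\<lambda>m. m $ j) ` S. y powi k * (\<Sum>m\<in>{m \<in> S. m $ j = k}. f m * (\<Prod>i\<in>J. z i powi (m $ i))))
        = (\<Sum>k\<in>(\<lambda>m. m $ j) ` S. \<Sum>m\<in>{m \<in> S. m $ j = k}. y powi (m $ j) * (f m * (\<Prod>i\<in>J. z i powi (m $ i))))"
      by (simp add: sum_distrib_left)
    also have "\<dots> = (\<Sum>m\<in>S. y powi (m $ j) * (f m * (\<Prod>i\<in>J. z i powi (m $ i))))"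
      using insert.prems(1) by (intro sum.group) auto
    also have "\<dots> = (\<Sum>m\<in>S. f m * (\<Prod>i\<in>insert j J. (z(j := y)) i powi (m $ i)))"
    proof (intro sum.cong refl)
      fix m
      have "(\<Prod>i\<in>J. (z(j := y)) i powi (m $ i)) = (\<Prod>i\<in>J. z i powi (m $ i))"
        using insert.hyps by (intro prod.cong) auto
      then show "y powi (m $ j) * (f m * (\<Prod>i\<in>J. z i powi (m $ i)))
          = f m * (\<Prod>i\<in>insert j J. (z(j := y)) i powi (m $ i))"
        using insert.hyps by simp
    qed
    also have "\<dots> = 0" using z y by (intro insert.prems(3)) auto
    finally show "(\<Sum>k\<in>(\<lambda>m. m $ j) ` S. y powi k * (\<Sum>m\<in>{m \<in> S. m $ j = k}. f m * (\<Prod>i\<in>J. z i powi (m $ i)))) = 0" .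
  qed (use Z insert.prems in auto)
  then show ?case
    using insert.prems by (intro insert.IH[of ?S n]) auto
qed

lemma plane_wave_eq_prod: "plane_wave i n x = (\<Prod>j\<in>UNIV - {i}. cis (2 * pi * x $ j) powi (n $ j))"
  by (simp add: plane_wave_def sum_distrib_left cis_sum cis_power_int mult_ac)

text \<open>On one layer the sum is a Laurent polynomial in the phases
  \<open>cis (2 * pi * x $ j)\<close>. The bound on \<open>E\<close> makes the set
  \<open>\<bar>fibre_symbol E i x\<bar> < 2\<close> contain a small box, hence a product of infinite
  sets of phases.\<close>

lemma plane_wave_sum_eq_0:
  fixes f :: "int ^ 'd \<Rightarrow> complex"
  assumes E: "\<bar>E\<bar> < 2 * real CARD('d)"
    and S: "finite S" "\<And>n. n \<in> S \<Longrightarrow> n $ i = p"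
    and eq: "\<And>x. x \<in> cbox 0 1 \<Longrightarrow> \<bar>fibre_symbol E i x\<bar> < 2 \<Longrightarrow> (\<Sum>n\<in>S. f n * plane_wave i n x) = 0"
    and n: "n \<in> S"
  shows "f n = 0"
proof -
  define d where "d = real CARD('d)"
  have d: "d \<ge> 1" by (simp add: d_def Suc_leI)
  have Ed: "\<bar>E / (2 * d)\<bar> < 1" using E d by (simp add: d_def)
  \<comment> \<open>On the diagonal, 2 cos (2 pi s) = E / d makes the fibre symbol E - (d - 1) E / d
    = E / d, of modulus below 2.\<close>
  define s where "s = arccos (E / (2 * d)) / (2 * pi)"
  have "0 < arccos (E / (2 * d))" "arccos (E / (2 * d)) < pi"
    using Ed arccos_lt_bounded[of "E / (2 * d)"] unfolding abs_less_iff by linarith+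
  then have s: "0 < s" "s < 1 / 2"
    by (auto simp: s_def field_simps)
  have "cos (2 * pi * s) = E / (2 * d)"
    using Ed by (simp add: s_def cos_arccos_abs)
  then have "fibre_symbol E i (\<chi> j. s) = E - real (CARD('d) - 1) * (2 * (E / (2 * d)))"
    by (simp add: fibre_symbol_def card_Diff_singleton)
  also have "\<dots> = E / d"
    using d by (simp add: d_def of_nat_diff Suc_leI field_simps)
  finally have "\<bar>fibre_symbol E i (\<chi> j. s)\<bar> < 2"
    using E by (simp add: d_def divide_less_eq)
  moreover have "open {x :: real ^ 'd. \<bar>fibre_symbol E i x\<bar> < 2}"
    by (intro open_Collect_less continuous_intros)
  ultimately obtain e where e: "e > 0" "ball (\<chi> j. s) e \<subseteq> {x. \<bar>fibre_symbol E i x\<bar> < 2}"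
    using openE by blast
  \<comment> \<open>The first bound keeps the l1 distance from the centre at most e / 2; the others
    keep coordinates in (0, 1/2), inside the cube and where the cosine is injective.\<close>
  define \<delta> where "\<delta> = min (e / (2 * d)) (min s (1 / 2 - s))"
  have \<delta>: "\<delta> > 0" using e s d by (simp add: \<delta>_def)
  define Y where "Y = {s - \<delta><..<s + \<delta>}"
  have Y: "0 < y" "y < 1 / 2" "\<bar>y - s\<bar> < e / (2 * d)" if "y \<in> Y" for y
    using that s by (auto simp: Y_def \<delta>_def min_def split: if_splits)
  define Z where "Z = (\<lambda>y. cis (2 * pi * y)) ` Y"
  have "inj_on (\<lambda>y. cis (2 * pi * y)) Y"
  proof (rule inj_onI)
    fix y y' assume y: "y \<in> Y" "y' \<in> Y" "cis (2 * pi * y) = cis (2 * pi * y')"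
    then have "cos (2 * pi * y) = cos (2 * pi * y')" by (metis cis.sel(1))
    moreover have "0 \<le> 2 * pi * y" "2 * pi * y \<le> pi" "0 \<le> 2 * pi * y'" "2 * pi * y' \<le> pi"
      using Y[OF y(1)] Y[OF y(2)] by auto
    ultimately have "2 * pi * y = 2 * pi * y'" using cos_inj_pi by blast
    then show "y = y'" by simp
  qed
  moreover have "infinite Y" using \<delta> by (simp add: Y_def infinite_Ioo)
  ultimately have Z: "infinite Z" "0 \<notin> Z"
    by (auto simp: Z_def finite_image_iff)
  show ?thesis
  proof (rule multi_laurent_eq_0[where J = "UNIV - {i}" and S = S and Z = Z])
    show "n = m" if "n \<in> S" "m \<in> S" "\<forall>j\<in>UNIV - {i}. n $ j = m $ j" for n m
      using that S(2)[of n] S(2)[of m] by (auto simp: vec_eq_iff)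
  next
    fix z :: "'d \<Rightarrow> complex" assume "\<And>j. z j \<in> Z"
    then have "\<forall>j. \<exists>y. y \<in> Y \<and> z j = cis (2 * pi * y)" by (auto simp: Z_def)
    then obtain y where y: "\<And>j. y j \<in> Y" "\<And>j. z j = cis (2 * pi * y j)" by metis
    define x where "x = (\<chi> j. y j)"
    have "0 \<le> y j \<and> y j \<le> 1" for j
      using Y[OF y(1)[of j]] by linarith
    then have "x \<in> cbox 0 1"
      by (simp add: mem_box_cart x_def)
    have "norm (x - (\<chi> j. s)) \<le> (\<Sum>j\<in>UNIV. \<bar>(x - (\<chi> j. s)) $ j\<bar>)"
      by (rule norm_le_l1_cart)
    also have "\<dots> \<le> (\<Sum>j\<in>(UNIV :: 'd set). e / (2 * d))"
      using Y(3)[OF y(1)] by (intro sum_mono) (auto simp: x_def less_imp_le)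
    also have "\<dots> < e" using e d by (simp add: d_def)
    finally have "x \<in> ball (\<chi> j. s) e" by (simp add: dist_norm norm_minus_commute)
    then have "\<bar>fibre_symbol E i x\<bar> < 2" using e by blast
    then have "(\<Sum>n\<in>S. f n * plane_wave i n x) = 0" using eq \<open>x \<in> cbox 0 1\<close> by blast
    then show "(\<Sum>n\<in>S. f n * (\<Prod>j\<in>UNIV - {i}. z j powi n $ j)) = 0"
      by (simp add: plane_wave_eq_prod y x_def)
  qed (use S n Z in auto)
qed

text \<open>The test wave solves the homogeneous equation and vanishes on layer \<open>q\<close>, so
  Green's identity isolates layer \<open>p\<close>. There it pairs the Fourier transform
  \<open>G\<close> with its conjugate, giving a zero integral of a nonnegative function that is
  positive wherever |t| < 2 and \<open>G\<close> is nonzero.\<close>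

lemma helmholtz_two_layers:
  fixes u :: "int ^ 'd \<Rightarrow> complex"
  assumes E: "\<bar>E\<bar> < 2 * real CARD('d)" and u: "sublinear_growth u"
    and fin: "finite {n. helmholtz E u n \<noteq> 0}"
    and lay: "\<And>n. helmholtz E u n \<noteq> 0 \<Longrightarrow> n $ i = p \<or> n $ i = q" and pq: "\<bar>p - q\<bar> = 1"
    and n: "n $ i = p"
  shows "helmholtz E u n = 0"
proof (rule ccontr)
  assume "helmholtz E u n \<noteq> 0"
  define F where "F = {n. helmholtz E u n \<noteq> 0}"
  define S where "S = {n \<in> F. n $ i = p}"
  have F: "finite F" using fin by (simp add: F_def)
  then have S: "finite S" by (simp add: S_def)
  define G where "G x = (\<Sum>n\<in>S. helmholtz E u n * plane_wave i n x)" for x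
  \<comment> \<open>The shift by \<open>q\<close> makes the sine vanish on that layer; on layer
    \<open>p\<close> it is the sign \<open>p - q\<close> times the squared sine of the
    angle.\<close>
  define a where "a k x = of_real (sine_sol (k - q) (fibre_symbol E i x)) * cnj (G x)" for k x
  have contG: "continuous_on A G" for A
    unfolding G_def by (intro continuous_intros)
  have cont: "continuous_on UNIV (a k)" for k
    unfolding a_def sine_sol_def by (intro continuous_intros contG)
  have bd: "cmod (a k x) \<le> 1 * (\<Sum>n\<in>S. cmod (helmholtz E u n))" for k x
  proof -
    have "cmod (G x) \<le> (\<Sum>n\<in>S. cmod (helmholtz E u n))"
      unfolding G_def by (rule order_trans[OF norm_sum]) (simp add: norm_mult)
    then show ?thesis
      unfolding a_def norm_mult complex_mod_cnj norm_of_real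
      by (intro mult_mono abs_sine_sol_le) auto
  qed
  have hw: "helmholtz E (wave i a) m = 0" for m
  proof -
    have "a (k + 1) x + a (k - 1) x - of_real (fibre_symbol E i x) * a k x = 0" for k x
    proof -
      have "a (k + 1) x + a (k - 1) x - of_real (fibre_symbol E i x) * a k x
        = of_real (sine_sol (k - q + 1) (fibre_symbol E i x) + sine_sol (k - q - 1) (fibre_symbol E i x)
            - fibre_symbol E i x * sine_sol (k - q) (fibre_symbol E i x)) * cnj (G x)"
        by (simp add: a_def algebra_simps)
      then show ?thesis by (simp add: sine_sol_rec)
    qed
    then show ?thesis by (simp add: helmholtz_wave[OF cont])
  qed
  define \<sigma> :: real where "\<sigma> = of_int (p - q)"
  have \<sigma>: "\<sigma> \<noteq> 0" and pq': "p - q = 1 \<or> p - q = - 1" using pq by (auto simp: \<sigma>_def)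
  have ap: "a p x = of_real (\<sigma> * (sin (angle (fibre_symbol E i x)))\<^sup>2) * cnj (G x)" for x
    using pq' by (elim disjE) (simp_all add: a_def sine_sol_def \<sigma>_def power2_eq_square del: of_int_diff)
  have "(\<Sum>n\<in>F. helmholtz E u n * wave i a n) = (\<Sum>n\<in>F. u n * helmholtz E (wave i a) n)"
    by (intro green_identity u linear_growth_wave[OF cont bd] F) (auto simp: F_def hw)
  then have "(\<Sum>n\<in>F. helmholtz E u n * wave i a n) = 0" by (simp add: hw)
  also have "(\<Sum>n\<in>F. helmholtz E u n * wave i a n) = (\<Sum>n\<in>S. helmholtz E u n * wave i a n)"
  proof (intro sum.mono_neutral_right ballI F)
    fix m assume "m \<in> F - S"
    then have "m $ i = q" using lay by (auto simp: F_def S_def)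
    then show "helmholtz E u m * wave i a m = 0" by (simp add: wave_def a_def sine_sol_def)
  qed (auto simp: S_def)
  finally have z: "(\<Sum>n\<in>S. helmholtz E u n * wave i a n) = 0" .
  have "((\<lambda>x. \<Sum>n\<in>S. helmholtz E u n * (a (n $ i) x * plane_wave i n x)) has_integral
      (\<Sum>n\<in>S. helmholtz E u n * wave i a n)) (cbox 0 1)"
    by (intro has_integral_sum S has_integral_mult_right has_integral_wave cont)
  moreover have "(\<Sum>n\<in>S. helmholtz E u n * (a (n $ i) x * plane_wave i n x))
      = of_real \<sigma> * of_real ((sin (angle (fibre_symbol E i x)))\<^sup>2 * (cmod (G x))\<^sup>2)" for x
  proof -
    have "(\<Sum>n\<in>S. helmholtz E u n * (a (n $ i) x * plane_wave i n x)) = a p x * G x"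
      unfolding G_def sum_distrib_left by (intro sum.cong refl) (auto simp: S_def mult_ac)
    also have "\<dots> = of_real (\<sigma> * (sin (angle (fibre_symbol E i x)))\<^sup>2) * (G x * cnj (G x))"
      by (simp add: ap mult_ac)
    finally show ?thesis
      unfolding complex_norm_square[symmetric] by (simp add: mult_ac)
  qed
  ultimately have "((\<lambda>x. of_real \<sigma> * of_real ((sin (angle (fibre_symbol E i x)))\<^sup>2 * (cmod (G x))\<^sup>2) :: complex)
      has_integral 0) (cbox 0 1)"
    by (simp add: z)
  from has_integral_mult_right[OF this, of "inverse (of_real \<sigma>)"]
  have "((\<lambda>x. of_real ((sin (angle (fibre_symbol E i x)))\<^sup>2 * (cmod (G x))\<^sup>2) :: complex) has_integral 0) (cbox 0 1)"
    using \<sigma> by (simp add: mult.assoc[symmetric])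
  from has_integral_linear[OF this bounded_linear_Re]
  have int0: "((\<lambda>x. (sin (angle (fibre_symbol E i x)))\<^sup>2 * (cmod (G x))\<^sup>2) has_integral 0) (cbox 0 1)"
    by (simp add: o_def)
  \<comment> \<open>A continuous nonnegative function with zero integral vanishes at every point of
    the cube.\<close>
  have z0: "(sin (angle (fibre_symbol E i x)))\<^sup>2 * (cmod (G x))\<^sup>2 = 0" if "x \<in> cbox 0 1" for x
  proof (rule has_integral_0_cbox_imp_0[OF _ _ int0 _ that])
    show "continuous_on (cbox 0 1) (\<lambda>x. (sin (angle (fibre_symbol E i x)))\<^sup>2 * (cmod (G x))\<^sup>2)"
      by (intro continuous_intros contG)
    show "box 0 1 \<noteq> ({} :: (real ^ 'd) set)"
      by (simp add: interval_ne_empty_cart)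
  qed auto
  have "G x = 0" if "x \<in> cbox 0 1" "\<bar>fibre_symbol E i x\<bar> < 2" for x
    using z0[OF that(1)] sin_angle_neq_0[OF that(2)] by simp
  then have "helmholtz E u n = 0"
    using n \<open>helmholtz E u n \<noteq> 0\<close>
    by (intro plane_wave_sum_eq_0[OF E S, of i p "helmholtz E u" n]) (auto simp: S_def F_def G_def)
  then show False using \<open>helmholtz E u n \<noteq> 0\<close> by simp
qed

text \<open>Division leaves \<open>v = u - w\<close> with sources on two adjacent layers. Those
  sources vanish, then so does \<open>v\<close>, and \<open>u\<close> equals the finitely supported
  \<open>w\<close>.\<close>

lemma rellich_finite_support:
  fixes u :: "int ^ 'd \<Rightarrow> complex"
  assumes E: "\<bar>E\<bar> < 2 * real CARD('d)" and u: "sublinear_growth u"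
    and fin: "finite {n. helmholtz E u n \<noteq> 0}"
  shows "finite {n. u n \<noteq> 0}"
proof -
  obtain i :: 'd where True by simp
  obtain r where r: "{n. helmholtz E u n \<noteq> 0} \<subseteq> lattice_ball r"
    using finite_imp_subset_lattice_ball[OF fin] .
  define b where "b = nat \<lceil>r\<rceil>"
  have "- int b \<le> n $ i \<and> n $ i \<le> - int b + 1 + int (2 * b)" if "helmholtz E u n \<noteq> 0" for n
  proof -
    have "\<bar>real_of_int (n $ i)\<bar> \<le> real b"
      using r that component_le_lattice_norm[of n i] unfolding b_def lattice_ball_def
      by (smt (verit, best) mem_Collect_eq of_nat_ceiling subset_eq)
    then show ?thesis by linarith
  qed
  from helmholtz_division[OF fin this, of E]
  obtain w where w: "finite {n. w n \<noteq> 0}"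
      "\<And>n. helmholtz E u n - helmholtz E w n \<noteq> 0 \<Longrightarrow> n $ i \<in> {- int b, - int b + 1}"
    by blast
  define v where "v n = u n - w n" for n
  have v: "sublinear_growth v" unfolding v_def by (rule sublinear_growth_diff_finite[OF u w(1)])
  have hv: "helmholtz E v n = helmholtz E u n - helmholtz E w n" for n
    by (simp add: v_def[abs_def] helmholtz_diff)
  have "{n. helmholtz E v n \<noteq> 0} \<subseteq> {n. helmholtz E u n \<noteq> 0} \<union> {n. helmholtz E w n \<noteq> 0}"
    by (auto simp: hv)
  then have finv: "finite {n. helmholtz E v n \<noteq> 0}"
    using fin finite_helmholtz[OF w(1)] finite_subset by blast
  have "helmholtz E v n = 0" for n
  proof (rule ccontr)
    assume "helmholtz E v n \<noteq> 0"
    then consider "n $ i = - int b" | "n $ i = - int b + 1" using w(2)[of n] by (auto simp: hv)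
    then show False
    \<comment> \<open>The two-layer lemma annihilates one named layer, so it is used with the roles
      of the layers exchanged.\<close>
    proof cases
      case 1
      then show ?thesis
        using helmholtz_two_layers[OF E v finv, of i "- int b" "- int b + 1" n] w(2) \<open>helmholtz E v n \<noteq> 0\<close>
        by (auto simp: hv)
    next
      case 2
      then show ?thesis
        using helmholtz_two_layers[OF E v finv, of i "- int b + 1" "- int b" n] w(2) \<open>helmholtz E v n \<noteq> 0\<close>
        by (auto simp: hv)
    qed
  qed
  then have "v n = 0" for n by (rule eq_0_of_helmholtz_eq_0[OF v])
  then have "u = w" by (auto simp: v_def fun_eq_iff)
  then show ?thesis using w(1) by simp
qed

theorem theorem2p3:
  fixes \<Omega> :: "(int ^ 'd) set"
    and V :: "int ^ 'd \<Rightarrow> real"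
    and u :: "int ^ 'd \<Rightarrow> complex"
    and lam R0 :: real
  assumes "CARD('d) \<ge> 2"
    and "exterior_domain \<Omega>"
    and "lattice_connected \<Omega>"
    and "cone_condition \<Omega>"
    and "compactly_supported_on \<Omega> V"
    and "0 < lam" and "lam < real CARD('d)"
    and "\<And>n. n \<in> lattice_interior \<Omega> \<Longrightarrow>
           disc_schroedinger V u n - complex_of_real lam * u n = 0"
    and "R0 > 0"
    and "{n. lattice_norm n > R0} \<subseteq> \<Omega>"
    and "((\<lambda>R::real. 1 / R * (\<Sum>n | R0 < lattice_norm n \<and> lattice_norm n < R. (cmod (u n))\<^sup>2))
           \<longlongrightarrow> 0) at_top"
  shows "\<forall>n\<in>\<Omega>. u n = 0"
proof -
  \<comment> \<open>Multiplying the equation by -4 gives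
    \<open>nbr_sum u = (2 d - 4 lam + 4 V) u\<close>; the range of \<open>lam\<close> places
    \<open>E\<close> strictly between -2 d and 2 d.\<close>
  define E where "E = 2 * real CARD('d) - 4 * lam"
  have E: "\<bar>E\<bar> < 2 * real CARD('d)"
    using assms(6,7) unfolding E_def by linarith
  have lap: "disc_laplacian u n = nbr_sum u n / 4 - of_nat CARD('d) / 2 * u n" for n
    by (simp add: disc_laplacian_def nbr_sum_def)
  have adj_u: "nbr_sum u n = (of_real E + 4 * of_real (V n)) * u n" if "n \<in> lattice_interior \<Omega>" for n
    using assms(8)[OF that]
    by (simp add: disc_schroedinger_def lap E_def field_simps)
  \<comment> \<open>Extension by zero spoils the equation only near the bounded complement of
    \<open>\<Omega>\<close>, so the source stays finitely supported.\<close>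
  define u' where "u' n = (if n \<in> \<Omega> then u n else 0)" for n
  obtain r1 where r1: "{n \<in> \<Omega>. V n \<noteq> 0} \<subseteq> lattice_ball r1"
    using assms(5) finite_imp_subset_lattice_ball unfolding compactly_supported_on_def by blast
  have far: "n \<in> \<Omega>" if "lattice_norm n > R0" for n
    using that assms(10) by blast
  \<comment> \<open>The radius \<open>R0 + 1\<close> ensures that the neighbours of \<open>n\<close>
    also lie beyond \<open>R0\<close>, hence in \<open>\<Omega>\<close>; beyond \<open>r1\<close>
    the potential vanishes.\<close>
  have "helmholtz E u' n = 0" if n: "n \<notin> lattice_ball (max r1 (R0 + 1))" for n
  proof -
    have nn: "lattice_norm n > r1" "lattice_norm n > R0 + 1"
      using n by (auto simp: lattice_ball_def)
    then have \<Omega>: "n \<in> \<Omega>" "n + axis j 1 \<in> \<Omega>" "n - axis j 1 \<in> \<Omega>" for j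
      using lattice_norm_add_axis_ge[of n j] by (auto intro!: far)
    then have "n \<in> lattice_interior \<Omega>" by (rule lattice_interiorI)
    moreover have "V n = 0"
      using r1 nn \<Omega>(1) by (force simp: lattice_ball_def)
    ultimately have "nbr_sum u n = of_real E * u n" by (simp add: adj_u)
    moreover have "nbr_sum u' n = nbr_sum u n" "u' n = u n"
      using \<Omega> by (simp_all add: nbr_sum_def u'_def)
    ultimately show ?thesis by (simp add: helmholtz_def)
  qed
  then have "{n. helmholtz E u' n \<noteq> 0} \<subseteq> lattice_ball (max r1 (R0 + 1))" by blast
  then have fin: "finite {n. helmholtz E u' n \<noteq> 0}"
    using finite_lattice_ball finite_subset by blast
  have "sublinear_growth u'"
    unfolding sublinear_growth_def
  proof (intro allI impI)
    fix \<epsilon> :: real assume \<epsilon>: "\<epsilon> > 0"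
    let ?S = "\<lambda>R. \<Sum>n | R0 < lattice_norm n \<and> lattice_norm n < R. (cmod (u n))\<^sup>2"
    \<comment> \<open>The limit controls only the mass outside \<open>R0\<close>; the rest is this
      constant, absorbed for large r.\<close>
    define K where "K = (\<Sum>n\<in>lattice_ball R0. (cmod (u' n))\<^sup>2)"
    have "eventually (\<lambda>R. 1 / R * ?S R < \<epsilon> / 4) at_top"
      using order_tendstoD(2)[OF assms(11), of "\<epsilon> / 4"] \<epsilon> by simp
    then obtain r2 where r2: "\<And>R. R \<ge> r2 \<Longrightarrow> 1 / R * ?S R < \<epsilon> / 4"
      unfolding eventually_at_top_linorder by blast
    show "\<exists>r0. \<forall>r\<ge>r0. (\<Sum>n\<in>lattice_ball r. (cmod (u' n))\<^sup>2) \<le> \<epsilon> * r"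
    proof (intro exI allI impI)
      fix r assume r: "r \<ge> max (max 1 r2) (2 * K / \<epsilon>)"
      then have r1': "r \<ge> 1" and r2': "r + 1 \<ge> r2" and rK: "2 * K / \<epsilon> \<le> r" by simp_all
      \<comment> \<open>The limit uses strict inequalities and the ball is closed, hence r + 1. Then
        \<epsilon> / 4 (r + 1) \<le> \<epsilon> r / 2, leaving \<epsilon> r / 2 for
        \<open>K\<close>.\<close>
      let ?A = "{n. R0 < lattice_norm n \<and> lattice_norm n < r + 1}"
      have finA: "finite ?A"
        by (rule finite_subset[OF _ finite_lattice_ball[of "r + 1"]]) (auto simp: lattice_ball_def)
      have "(\<Sum>n\<in>lattice_ball r. (cmod (u' n))\<^sup>2) \<le> (\<Sum>n\<in>lattice_ball R0 \<union> ?A. (cmod (u' n))\<^sup>2)"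
      proof (rule sum_mono2)
        show "lattice_ball r \<subseteq> lattice_ball R0 \<union> ?A" by (auto simp: lattice_ball_def)
      qed (use finA in auto)
      also have "\<dots> = K + (\<Sum>n\<in>?A. (cmod (u' n))\<^sup>2)"
        unfolding K_def
      proof (rule sum.union_disjoint)
        show "lattice_ball R0 \<inter> ?A = {}" by (auto simp: lattice_ball_def)
      qed (use finA in auto)
      also have "(\<Sum>n\<in>?A. (cmod (u' n))\<^sup>2) = ?S (r + 1)"
        by (intro sum.cong refl) (simp add: u'_def far)
      also have "?S (r + 1) = 1 / (r + 1) * ?S (r + 1) * (r + 1)"
        using r1' by simp
      also have "\<dots> \<le> \<epsilon> / 4 * (r + 1)"
        using r1' by (intro mult_right_mono less_imp_le[OF r2[OF r2']]) simp
      also have "\<dots> \<le> \<epsilon> / 4 * (2 * r)"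
        using r1' \<epsilon> by (intro mult_left_mono) auto
      also have "K \<le> \<epsilon> * r / 2"
        using rK \<epsilon> by (simp add: field_simps)
      finally show "(\<Sum>n\<in>lattice_ball r. (cmod (u' n))\<^sup>2) \<le> \<epsilon> * r" by simp
    qed
  qed
  then have "finite {n. u' n \<noteq> 0}"
    by (rule rellich_finite_support[OF E _ fin])
  moreover have "{n. u' n \<noteq> 0} = {n \<in> \<Omega>. u n \<noteq> 0}"
    by (auto simp: u'_def)
  ultimately have finu: "finite {n \<in> \<Omega>. u n \<noteq> 0}" by simp
  show ?thesis
  proof
    fix n assume "n \<in> \<Omega>"
    then obtain i s where "s \<in> {1, -1}" "lattice_cone i s n \<subseteq> \<Omega>"
      using assms(4) unfolding cone_condition_def by blast
    then show "u n = 0"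
      \<comment> \<open>By \<open>adj_u\<close> the neighbour sum is a multiple of \<open>u\<close>,
        also where the potential is nonzero, so it vanishes at zeros of \<open>u\<close> in the
        interior.\<close>
      by (intro cone_unique_continuation[of i s n \<Omega> u] finu) (simp_all add: adj_u)
  qed
qed

end
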